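(* Let $z\in\mathbb{S}^1$, let $\phi$ be the width with respect to $z$ and let $P\subset\mathbb{R}^2$ be a convex polygon. Then $P$ is determined by the knowledge of $\phi$ and of $g_{P,\phi}$, up to translations and reflections, within the class of all planar convex bodies; that is, if $Q$ is a planar convex body with $g_{Q,\phi}=g_{P,\phi}$, then $Q=P+\tau$ or $Q=-P+\tau$ for some $\tau\in\mathbb{R}^2$.
   Context: A planar convex body is a compact convex subset of $\mathbb{R}^2$ with nonempty interior; a convex polygon is a planar convex body that is a polygon. $\mathbb{S}^1$ is the Euclidean unit circle. For a nonempty compact convex set $K\subset\mathbb{R}^2$ the width with respect to $z$ is $\phi(K)=w(K,z)=\max_{x\in K}\langle x,z\rangle-\min_{x\in K}\langle x,z\rangle$, and $\phi(\emptyset)=0$. For a planar convex body $K$, the $\phi$-covariogram is $g_{K,\phi}:\mathbb{R}^2\to\mathbb{R}$, $g_{K,\phi}(x)=\phi(K\cap(K+x))$. Reflection always means reflection at a point. *)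

theory Defs
  imports "HOL-Analysis.Analysis"
begin

definition planar_convex_body :: "(real^2) set \<Rightarrow> bool" where
  "planar_convex_body K \<longleftrightarrow> compact K \<and> convex K \<and> interior K \<noteq> {}"

definition convex_polygon :: "(real^2) set \<Rightarrow> bool" where
  "convex_polygon P \<longleftrightarrow> planar_convex_body P \<and> polytope P"

text \<open>The supremum and the infimum are attained on nonempty compact sets, see
  \<open>width_attained\<close> below. On other nonempty sets the value has no intended meaning.\<close>

definition width :: "real^2 \<Rightarrow> (real^2) set \<Rightarrow> real" where
  "width z K = (if K = {} then 0 else (SUP x\<in>K. x \<bullet> z) - (INF x\<in>K. x \<bullet> z))"

definition covariogram :: "((real^2) set \<Rightarrow> real) \<Rightarrow> (real^2) set \<Rightarrow> real^2 \<Rightarrow> real" where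
  "covariogram \<phi> K x = \<phi> (K \<inter> (\<lambda>y. y + x) ` K)"

lemma width_attained:
  assumes "compact K" "K \<noteq> {}"
  obtains a b where "a \<in> K" "b \<in> K" "\<And>x. x \<in> K \<Longrightarrow> b \<bullet> z \<le> x \<bullet> z \<and> x \<bullet> z \<le> a \<bullet> z"
    "width z K = a \<bullet> z - b \<bullet> z"
proof -
  have c: "continuous_on K (\<lambda>x. x \<bullet> z)"
    by (intro continuous_intros)
  obtain a where a: "a \<in> K" "\<And>x. x \<in> K \<Longrightarrow> x \<bullet> z \<le> a \<bullet> z"
    using continuous_attains_sup[OF assms c] by blast
  obtain b where b: "b \<in> K" "\<And>x. x \<in> K \<Longrightarrow> b \<bullet> z \<le> x \<bullet> z"
    using continuous_attains_inf[OF assms c] by blast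
  have "(SUP x\<in>K. x \<bullet> z) = a \<bullet> z"
    using a by (intro cSup_eq_maximum) auto
  moreover have "(INF x\<in>K. x \<bullet> z) = b \<bullet> z"
    using b by (intro cInf_eq_minimum) auto
  ultimately have "width z K = a \<bullet> z - b \<bullet> z"
    using assms(2) by (simp add: width_def)
  with a b show thesis by (intro that[of a b]) auto
qed

end

theory Submission
  imports Defs "HOL-Probability.Distribution_Functions"
begin

text \<open>
  Let \<open>e\<close> be a unit vector orthogonal to \<open>z\<close>. Up to translation a planar convex body is
  \<open>{s e + t z | 0 \<le> t \<le> h, - q(t) \<le> s \<le> p(h - t)}\<close> with \<open>p\<close>, \<open>q\<close> concave on \<open>[0, h]\<close> and \<open>p(0) = q(0)\<close>, and
  point reflection exchanges \<open>p\<close> and \<open>q\<close>. The covariogram at \<open>a e + (h - n) z\<close> is the length of the set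
  of \<open>x \<in> [0, n]\<close> with \<open>a \<le> p(x) + q(n - x)\<close> and \<open>- a \<le> q(h - x) + p(h - n + x)\<close>. A shift along a segment
  from bottom to top satisfies both constraints everywhere, so beyond it one of them is void, and the
  covariogram yields the distribution of \<open>p(x) + q(n - x)\<close> on \<open>[0, n]\<close> for each \<open>n\<close>, as well as that of
  its mirror image.

  The minimum and the first moment of this distribution give \<open>min p q\<close> and \<open>p + q\<close>, hence \<open>d\<^sup>2\<close> for
  \<open>d = p - q\<close>; the second moment gives the convolution \<open>d * d\<close> on \<open>[0, h]\<close>. If \<open>d'\<close> belongs to a second body
  with the same covariogram, then \<open>d' = \<plusminus> d\<close> pointwise and \<open>(d - d') * (d + d') = 0\<close> on \<open>[0, h]\<close>. For a
  polygon \<open>d\<close> is piecewise affine, so \<open>d \<plusminus> d'\<close> have locally constant signs, and comparing their first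
  sign changes, from the bottom or from the top, shows that the sign in \<open>d' = \<plusminus> d\<close> is global.
\<close>

subsection \<open>Equimeasurable functions\<close>

text \<open>Equal superlevel measures mean that \<open>- f\<close> and \<open>- g\<close> push
  Lebesgue measure on the interval to measures with the same cumulative distribution function, hence
  to the same measure. The sign turns superlevel sets into preimages of the half-lines
  \<open>{..c}\<close>.\<close>

lemma integral_comp_eq_if_equimeasurable:
  fixes f g \<phi> :: "real \<Rightarrow> real"
  assumes f: "continuous_on {a..b} f" and g: "continuous_on {a..b} g"
    and eq: "\<And>c. measure lborel {x\<in>{a..b}. c \<le> f x} = measure lborel {x\<in>{a..b}. c \<le> g x}"
    and \<phi>: "continuous_on UNIV \<phi>"
  shows "integral {a..b} (\<lambda>x. \<phi> (f x)) = integral {a..b} (\<lambda>x. \<phi> (g x))"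
proof -
  define R where "R = restrict_space lborel {a..b}"
  define M where "M f = distr R borel (\<lambda>x. - f x)" for f :: "real \<Rightarrow> real"
  have space_R: "space R = {a..b}"
    by (simp add: R_def space_restrict_space)
  have fin: "finite_measure R"
    by (rule finite_measureI) (simp add: space_R R_def emeasure_restrict_space emeasure_lborel_Icc_eq)
  have meas: "(\<lambda>x. - f x) \<in> borel_measurable R" if "continuous_on {a..b} f" for f :: "real \<Rightarrow> real"
  proof -
    have "(\<lambda>x. - f x) \<in> borel_measurable (restrict_space borel {a..b})"
      by (rule borel_measurable_continuous_on_restrict) (intro continuous_intros that)
    then show ?thesis
      by (simp add: R_def measurable_cong_sets[OF sets_restrict_space_cong[OF sets_lborel] refl])
  qed
  have fbm: "finite_borel_measure (M f)" if "continuous_on {a..b} f" for f :: "real \<Rightarrow> real"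
    unfolding M_def finite_borel_measure_def finite_borel_measure_axioms_def
    using finite_measure.finite_measure_distr[OF fin meas[OF that]] by simp
  have cdf: "cdf (M f) c = measure lborel {x\<in>{a..b}. - c \<le> f x}"
    if "continuous_on {a..b} f" for f :: "real \<Rightarrow> real" and c
  proof -
    have "cdf (M f) c = measure R ((\<lambda>x. - f x) -` {..c} \<inter> space R)"
      unfolding cdf_def M_def by (rule measure_distr[OF meas[OF that]]) simp
    also have "(\<lambda>x. - f x) -` {..c} \<inter> space R = {x\<in>{a..b}. - c \<le> f x}"
      by (auto simp: space_R)
    also have "measure R \<dots> = measure lborel {x\<in>{a..b}. - c \<le> f x}"
      unfolding R_def by (rule measure_restrict_space) auto
    finally show ?thesis .
  qed
  have "M f = M g"
    by (rule cdf_unique'[OF fbm[OF f] fbm[OF g]]) (simp only: fun_eq_iff cdf[OF f] cdf[OF g] eq simp_thms)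
  moreover have "integral {a..b} (\<lambda>x. \<phi> (f x)) = integral\<^sup>L (M f) (\<lambda>y. \<phi> (- y))"
    if "continuous_on {a..b} f" for f :: "real \<Rightarrow> real"
  proof -
    have c: "continuous_on {a..b} (\<lambda>x. \<phi> (f x))"
      by (rule continuous_on_compose2[OF \<phi> that]) simp
    have "integral\<^sup>L (M f) (\<lambda>y. \<phi> (- y)) = integral\<^sup>L R (\<lambda>x. \<phi> (- (- f x)))"
      unfolding M_def
      by (rule integral_distr[OF meas[OF that]])
        (intro borel_measurable_continuous_onI continuous_on_compose2[OF \<phi>] continuous_intros, simp)
    also have "\<dots> = (LINT x:{a..b}|lborel. \<phi> (f x))"
      unfolding R_def set_lebesgue_integral_def by (subst integral_restrict_space) simp_all
    also have "\<dots> = integral {a..b} (\<lambda>x. \<phi> (f x))"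
      by (rule set_borel_integral_eq_integral, rule borel_integrable_atLeastAtMost')
        (rule c)
    finally show ?thesis by simp
  qed
  ultimately show ?thesis using f g by simp
qed

text \<open>The test function \<open>max 0 (m - y)\<close> has integral 0 along \<open>f\<close>,
  hence along \<open>g\<close>; a nonnegative continuous function with integral 0 vanishes
  everywhere, not only almost everywhere.\<close>

lemma ge_if_equimeasurable:
  fixes f g :: "real \<Rightarrow> real"
  assumes f: "continuous_on {a..b} f" and g: "continuous_on {a..b} g" and "a < b"
    and eq: "\<And>c. measure lborel {x\<in>{a..b}. c \<le> f x} = measure lborel {x\<in>{a..b}. c \<le> g x}"
    and f_ge: "\<And>x. x \<in> {a..b} \<Longrightarrow> m \<le> f x" and x: "x \<in> {a..b}"
  shows "m \<le> g x"
proof -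
  have "integral {a..b} (\<lambda>x. max 0 (m - g x)) = integral {a..b} (\<lambda>x. max 0 (m - f x))"
    using integral_comp_eq_if_equimeasurable[OF f g eq, of "\<lambda>y. max 0 (m - y)"]
    by (simp add: continuous_on_max continuous_on_diff continuous_on_id)
  also have "\<dots> = integral {a..b} (\<lambda>x. 0)"
    by (rule integral_cong) (use f_ge in auto)
  finally have "integral {a..b} (\<lambda>x. max 0 (m - g x)) = 0" by simp
  moreover have "continuous_on {a..b} (\<lambda>x. max 0 (m - g x))"
    by (intro continuous_intros g)
  ultimately have "\<forall>x\<in>{a..b}. max 0 (m - g x) = 0"
    using integral_eq_0_iff[of a b "\<lambda>x. max 0 (m - g x)"] \<open>a < b\<close> by simp
  then show ?thesis using x by (force simp: max_def split: if_splits)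
qed

lemma integral_reflect_Icc:
  fixes f :: "real \<Rightarrow> real"
  shows "integral {0..n} (\<lambda>x. f (n - x)) = integral {0..n} f"
proof -
  have "integral {0..n} (\<lambda>x. f (n - x)) = integral {-n..0} (\<lambda>x. f (n + x))"
    using Henstock_Kurzweil_Integration.integral_reflect_real[of 0 "-n" "\<lambda>x. f (n + x)"] by simp
  also have "\<dots> = integral {0..n} f"
    using integral_shift_real_ivl[of 0 n n f] by (simp add: add.commute)
  finally show ?thesis .
qed

lemma continuous_integral_zero_imp_zero:
  fixes f :: "real \<Rightarrow> real"
  assumes f: "continuous_on {0..h} f" and "0 < h"
    and int: "\<And>n. n \<in> {0<..h} \<Longrightarrow> integral {0..n} f = 0"
    and x: "x \<in> {0..h}"
  shows "f x = 0"
proof -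
  have 1: "((\<lambda>x. integral {0..x} f) has_vector_derivative f x) (at x within {0..h})"
    by (rule integral_has_vector_derivative[OF f x])
  have 0: "integral {0..n} f = 0" if "n \<in> {0..h}" for n
    using int[of n] that by (cases "n = 0") auto
  have "((\<lambda>x. 0) has_vector_derivative f x) (at x within cbox 0 h)"
    using has_vector_derivative_transform[OF x _ 1, of "\<lambda>x. 0"] 0 by simp
  moreover have "((\<lambda>x. 0::real) has_vector_derivative 0) (at x within cbox 0 h)"
    by simp
  ultimately show ?thesis
    using vector_derivative_unique_within_closed_interval[of 0 h x] x \<open>0 < h\<close> by (metis cbox_interval)
qed

subsection \<open>Moments of the distribution\<close>

lemma concave_on_affine_comp:
  fixes f :: "real \<Rightarrow> real"
  assumes f: "concave_on S f" and "convex T" and T: "\<And>x. x \<in> T \<Longrightarrow> \<alpha> * x + \<beta> \<in> S"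
  shows "concave_on T (\<lambda>x. f (\<alpha> * x + \<beta>) + k)"
  unfolding concave_on_iff
proof (intro conjI ballI allI impI)
  fix x y u v :: real assume a: "x \<in> T" "y \<in> T" "0 \<le> u" "0 \<le> v" "u + v = 1"
  have "u * f (\<alpha> * x + \<beta>) + v * f (\<alpha> * y + \<beta>) \<le> f (u *\<^sub>R (\<alpha> * x + \<beta>) + v *\<^sub>R (\<alpha> * y + \<beta>))"
    using f a T unfolding concave_on_iff by blast
  also have "u *\<^sub>R (\<alpha> * x + \<beta>) + v *\<^sub>R (\<alpha> * y + \<beta>) = \<alpha> * (u *\<^sub>R x + v *\<^sub>R y) + (u + v) * \<beta>"
    by (simp add: algebra_simps)
  also have "\<dots> = \<alpha> * (u *\<^sub>R x + v *\<^sub>R y) + \<beta>" using a by simp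
  finally have "u * f (\<alpha> * x + \<beta>) + v * f (\<alpha> * y + \<beta>) \<le> f (\<alpha> * (u *\<^sub>R x + v *\<^sub>R y) + \<beta>)" .
  moreover have "u * k + v * k = k" using a(5) by (simp add: distrib_right[symmetric])
  ultimately show "u * (f (\<alpha> * x + \<beta>) + k) + v * (f (\<alpha> * y + \<beta>) + k) \<le> f (\<alpha> * (u *\<^sub>R x + v *\<^sub>R y) + \<beta>) + k"
    by (simp add: distrib_left)
qed (rule assms)

lemma continuous_on_affine_comp:
  fixes f :: "real \<Rightarrow> real"
  assumes "continuous_on S f" and T: "\<And>x. x \<in> T \<Longrightarrow> \<alpha> * x + \<beta> \<in> S"
  shows "continuous_on T (\<lambda>x. f (\<alpha> * x + \<beta>) + k)"
  by (intro continuous_intros continuous_on_compose2[OF assms(1)]) (use T in auto)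

lemma continuous_on_reflect_Icc:
  fixes f :: "real \<Rightarrow> real"
  assumes "continuous_on {0..h} f" "n \<le> h"
  shows "continuous_on {0..n} (\<lambda>x. f (n - x))"
  using continuous_on_affine_comp[OF assms(1), of "{0..n}" "- 1" n 0] assms(2) by simp

lemma concave_on_reflect_Icc:
  fixes f :: "real \<Rightarrow> real"
  assumes "concave_on {0..h} f" "n \<le> h"
  shows "concave_on {0..n} (\<lambda>x. f (n - x))"
  using concave_on_affine_comp[OF assms(1), of "{0..n}" "- 1" n 0] assms(2) by simp

text \<open>The level \<open>c\<close> comes last so that equality of whole distributions is an
  equation between functions.\<close>

definition sum_dist :: "(real \<Rightarrow> real) \<Rightarrow> (real \<Rightarrow> real) \<Rightarrow> real \<Rightarrow> real \<Rightarrow> real" where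
  "sum_dist p q n c = measure lborel {x\<in>{0..n}. c \<le> p x + q (n - x)}"

lemma continuous_on_conv_sum:
  fixes p q :: "real \<Rightarrow> real"
  assumes "continuous_on {0..h} p" "continuous_on {0..h} q" "n \<le> h"
  shows "continuous_on {0..n} (\<lambda>x. p x + q (n - x))"
  using assms by (intro continuous_on_add continuous_on_reflect_Icc[of h]) (auto intro: continuous_on_subset)

text \<open>First moments: reflecting \<open>q\<close> turns the integral of
  \<open>p x + q (n - x)\<close> over \<open>[0, n]\<close> into that of \<open>p + q\<close>, and
  differentiation in \<open>n\<close> gives the pointwise equality.\<close>

lemma sum_eq_if_sum_dist_eq:
  fixes p q p' q' :: "real \<Rightarrow> real"
  assumes cont: "continuous_on {0..h} p" "continuous_on {0..h} q"
      "continuous_on {0..h} p'" "continuous_on {0..h} q'" and "0 < h"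
    and dist: "\<And>n. n \<in> {0<..h} \<Longrightarrow> sum_dist p q n = sum_dist p' q' n"
    and x: "x \<in> {0..h}"
  shows "p x + q x = p' x + q' x"
proof -
  have split: "integral {0..n} (\<lambda>x. p x + q (n - x)) = integral {0..n} (\<lambda>x. p x + q x)"
    if c: "continuous_on {0..h} p" "continuous_on {0..h} q" and n: "n \<in> {0<..h}" for p q :: "real \<Rightarrow> real" and n
  proof -
    have s: "continuous_on {0..n} p" "continuous_on {0..n} q"
      using c n by (auto intro: continuous_on_subset)
    have "integral {0..n} (\<lambda>x. p x + q (n - x)) = integral {0..n} p + integral {0..n} (\<lambda>x. q (n - x))"
      using s n by (intro integral_add integrable_continuous_real continuous_on_reflect_Icc[OF c(2)]) auto
    also have "\<dots> = integral {0..n} (\<lambda>x. p x + q x)"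
      unfolding integral_reflect_Icc
      by (rule integral_add[symmetric]) (intro integrable_continuous_real s)+
    finally show ?thesis .
  qed
  have "(p x + q x) - (p' x + q' x) = 0"
  proof (rule continuous_integral_zero_imp_zero[OF _ \<open>0 < h\<close> _ x])
    fix n assume n: "n \<in> {0<..h}"
    have eq: "integral {0..n} (\<lambda>x. p x + q x) = integral {0..n} (\<lambda>x. p' x + q' x)"
      unfolding split[OF cont(1,2) n, symmetric] split[OF cont(3,4) n, symmetric]
      by (rule integral_comp_eq_if_equimeasurable[where \<phi> = "\<lambda>y. y"])
        (use n dist[OF n] in \<open>auto intro!: continuous_on_conv_sum[OF cont(1,2)] continuous_on_conv_sum[OF cont(3,4)]
          simp: sum_dist_def fun_eq_iff\<close>)
    have "integral {0..n} (\<lambda>x. p x + q x - (p' x + q' x))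
        = integral {0..n} (\<lambda>x. p x + q x) - integral {0..n} (\<lambda>x. p' x + q' x)"
      using n by (intro integral_diff integrable_continuous_real continuous_intros
          cont[THEN continuous_on_subset]) auto
    with eq show "integral {0..n} (\<lambda>x. p x + q x - (p' x + q' x)) = 0" by simp
  qed (intro continuous_intros cont)
  then show ?thesis by simp
qed

lemma concave_on_Icc_ge_min:
  fixes f :: "real \<Rightarrow> real"
  assumes "concave_on {a..b} f" "x \<in> {a..b}"
  shows "min (f a) (f b) \<le> f x"
proof (cases "a = b")
  case False
  then have ab: "a < b" using assms(2) by auto
  define t where "t = (x - a) / (b - a)"
  have t: "0 \<le> t" "t \<le> 1" using assms(2) ab by (auto simp: t_def field_simps)
  have "t * (b - a) = x - a" using ab by (simp add: t_def)
  then have x: "x = (1 - t) *\<^sub>R a + t *\<^sub>R b" by (simp add: algebra_simps)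
  have "(1 - t) * f a + t * f b \<le> f x"
    unfolding x using concave_onD[OF assms(1) t] ab by simp
  moreover have "(1 - t) * min (f a) (f b) + t * min (f a) (f b) \<le> (1 - t) * f a + t * f b"
    using t by (intro add_mono mult_left_mono) auto
  ultimately show ?thesis by (simp add: algebra_simps)
qed (use assms in auto)

lemma concave_on_conv_sum:
  fixes p q :: "real \<Rightarrow> real"
  assumes "concave_on {0..h} p" "concave_on {0..h} q" "n \<le> h"
  shows "concave_on {0..n} (\<lambda>x. p x + q (n - x))"
proof (rule concave_on_add)
  show "concave_on {0..n} p"
    using assms(1,3) unfolding concave_on_iff by auto
qed (rule concave_on_reflect_Icc[OF assms(2,3)])

text \<open>A concave function on an interval attains its minimum at an endpoint, so the distribution
  of \<open>p x + q (n - x)\<close> on \<open>[0, n]\<close> determines \<open>min (p n) (q n)\<close>.\<close>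

lemma diff_sq_eq_if_sum_dist_eq:
  fixes p q p' q' :: "real \<Rightarrow> real"
  assumes cont: "continuous_on {0..h} p" "continuous_on {0..h} q"
      "continuous_on {0..h} p'" "continuous_on {0..h} q'"
    and conc: "concave_on {0..h} p" "concave_on {0..h} q"
      "concave_on {0..h} p'" "concave_on {0..h} q'" and "0 < h"
    and dist: "\<And>n. n \<in> {0<..h} \<Longrightarrow> sum_dist p q n = sum_dist p' q' n"
    and zero: "p 0 = q 0" "p' 0 = q' 0"
    and n: "n \<in> {0..h}"
  shows "(p n - q n)\<^sup>2 = (p' n - q' n)\<^sup>2"
proof (cases "n = 0")
  case False
  then have n': "n \<in> {0<..h}" and [arith]: "0 < n" "n \<le> h" using n by auto
  \<comment> \<open>Stated for arbitrary pairs, so that exchanging them yields equality. The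
    endpoints \<open>n\<close> and 0 give the two values under \<open>min\<close>.\<close>
  have min_le: "min (p n + q 0) (p 0 + q n) \<le> min (p' n + q' 0) (p' 0 + q' n)"
    if cont: "continuous_on {0..h} p" "continuous_on {0..h} q"
      "continuous_on {0..h} p'" "continuous_on {0..h} q'"
    and conc: "concave_on {0..h} p" "concave_on {0..h} q"
    and dist: "sum_dist p q n = sum_dist p' q' n" for p q p' q' :: "real \<Rightarrow> real"
  proof -
    have ge: "min (p n + q 0) (p 0 + q n) \<le> p' x + q' (n - x)" if x: "x \<in> {0..n}" for x
    proof (rule ge_if_equimeasurable[where g = "\<lambda>x. p' x + q' (n - x)", OF
          continuous_on_conv_sum[OF cont(1,2)] continuous_on_conv_sum[OF cont(3,4)] _ _ _ x])
      show "min (p n + q 0) (p 0 + q n) \<le> p x + q (n - x)" if "x \<in> {0..n}" for x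
        using concave_on_Icc_ge_min[OF concave_on_conv_sum[OF conc, of n] that] by (simp add: min.commute)
      show "measure lborel {x \<in> {0..n}. c \<le> p x + q (n - x)}
          = measure lborel {x \<in> {0..n}. c \<le> p' x + q' (n - x)}" for c
        using fun_cong[OF dist, of c] by (simp add: sum_dist_def)
    qed auto
    from ge[of 0] ge[of n] show ?thesis by simp
  qed
  have "min (p n + q 0) (p 0 + q n) = min (p' n + q' 0) (p' 0 + q' n)"
    by (rule antisym; rule min_le) (use cont conc dist[OF n'] in auto)
  moreover have S: "p x + q x = p' x + q' x" if "x \<in> {0..h}" for x
    by (rule sum_eq_if_sum_dist_eq[OF cont \<open>0 < h\<close> dist that])
  \<comment> \<open>At 0 each sum is twice a common value, so the summands at 0 cancel from the
    minima. Then \<open>\<bar>p n - q n\<bar>\<close> is the sum minus twice the minimum.\<close>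
  have "p 0 = p' 0" using S[of 0] zero by simp
  ultimately have "min (p n) (q n) = min (p' n) (q' n)"
    using zero by (simp add: min_def split: if_splits)
  then have "\<bar>p n - q n\<bar> = \<bar>p' n - q' n\<bar>"
    using S[OF n] by (simp add: min_def split: if_splits)
  then show ?thesis by (simp add: power2_eq_iff abs_eq_iff)
qed (use zero in simp)

text \<open>Second moments: with \<open>d = p - q\<close> and \<open>e = p' - q'\<close>, the
  integrand is -2 times the difference of the squares of the two sums, up to terms antisymmetric
  under \<open>x \<mapsto> n - x\<close> and terms that vanish by
  \<open>d\<^sup>2 = e\<^sup>2\<close>.\<close>

lemma conv_eq_0_if_sum_dist_eq:
  fixes p q p' q' :: "real \<Rightarrow> real"
  assumes cont: "continuous_on {0..h} p" "continuous_on {0..h} q"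
      "continuous_on {0..h} p'" "continuous_on {0..h} q'"
    and n: "n \<in> {0..h}"
    and dist: "sum_dist p q n = sum_dist p' q' n"
    and sum: "\<And>x. x \<in> {0..h} \<Longrightarrow> p x + q x = p' x + q' x"
    and diff: "\<And>x. x \<in> {0..h} \<Longrightarrow> (p x - q x)\<^sup>2 = (p' x - q' x)\<^sup>2"
  shows "integral {0..n} (\<lambda>x. (p x - q x - (p' x - q' x)) * (p (n - x) - q (n - x) + (p' (n - x) - q' (n - x)))) = 0"
    (is "integral _ (\<lambda>x. ?u x * ?v (n - x)) = 0")
proof -
  define S d e where "S x = p x + q x" and "d x = p x - q x" and "e x = p' x - q' x" for x
  \<comment> \<open>the part antisymmetric under \<open>x \<mapsto> n - x\<close>, which integrates to 0\<close>
  define A where "A x = (S x + S (n - x)) * ((d x - d (n - x)) - (e x - e (n - x)))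
      + (d x * e (n - x) - e x * d (n - x))" for x
  have le: "n \<le> h" using n by simp
  note cont' = continuous_on_conv_sum[OF cont(1,2) le] continuous_on_conv_sum[OF cont(3,4) le]
  have dec: "?u x * ?v (n - x) = A x - 2 * ((p x + q (n - x))\<^sup>2 - (p' x + q' (n - x))\<^sup>2)"
    if x: "x \<in> {0..n}" for x
  proof -
    have mem: "x \<in> {0..h}" "n - x \<in> {0..h}" using x n by auto
    have F: "p x + q (n - x) = (S x + S (n - x) + d x - d (n - x)) / 2"
      "p' x + q' (n - x) = (S x + S (n - x) + e x - e (n - x)) / 2"
      using sum[OF mem(1)] sum[OF mem(2)] by (simp_all add: S_def d_def e_def field_simps)
    have sq: "(d x)\<^sup>2 = (e x)\<^sup>2" "(d (n - x))\<^sup>2 = (e (n - x))\<^sup>2"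
      using diff[OF mem(1)] diff[OF mem(2)] by (simp_all add: d_def e_def)
    \<comment> \<open>Here \<open>a\<close>, \<open>b\<close> stand for \<open>d\<close>,
      \<open>e\<close> at \<open>x\<close>, while \<open>a'\<close>, \<open>b'\<close> are their
      values at \<open>n - x\<close> and \<open>T\<close> is \<open>S x + S (n - x)\<close>. The
      last summand vanishes by \<open>sq\<close>.\<close>
    have "(a - b) * (a' + b') = T * ((a - a') - (b - b')) + (a * b' - b * a')
        - 2 * (((T + a - a') / 2)\<^sup>2 - ((T + b - b') / 2)\<^sup>2) + ((a\<^sup>2 - b\<^sup>2) + (a'\<^sup>2 - b'\<^sup>2)) / 2"
      for a b a' b' T :: real
      by (simp add: power2_eq_square field_simps)
    from this[of "d x" "e x" "d (n - x)" "e (n - x)" "S x + S (n - x)"]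
    have "(d x - e x) * (d (n - x) + e (n - x))
      = A x - 2 * ((p x + q (n - x))\<^sup>2 - (p' x + q' (n - x))\<^sup>2)"
      unfolding F A_def using sq by simp
    then show ?thesis by (simp add: d_def e_def)
  qed
  have contd: "continuous_on {0..h} S" "continuous_on {0..h} d" "continuous_on {0..h} e"
    unfolding S_def d_def e_def by (intro continuous_intros cont)+
  have contA: "continuous_on {0..n} A"
    unfolding A_def
    using contd le by (intro continuous_intros continuous_on_reflect_Icc[of h])
      (auto intro: continuous_on_subset)
  have "integral {0..n} A = integral {0..n} (\<lambda>x. A (n - x))"
    by (rule integral_reflect_Icc[symmetric])
  also have "\<dots> = integral {0..n} (\<lambda>x. - A x)"
    by (rule integral_cong) (simp add: A_def algebra_simps)
  finally have A0: "integral {0..n} A = 0" by simp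
  have sq: "integral {0..n} (\<lambda>x. (p x + q (n - x))\<^sup>2) = integral {0..n} (\<lambda>x. (p' x + q' (n - x))\<^sup>2)"
    by (rule integral_comp_eq_if_equimeasurable[where \<phi> = "\<lambda>y. y\<^sup>2", OF cont'])
      (use fun_cong[OF dist] in \<open>auto simp: sum_dist_def intro!: continuous_intros\<close>)
  have "integral {0..n} (\<lambda>x. ?u x * ?v (n - x))
      = integral {0..n} (\<lambda>x. A x - 2 * ((p x + q (n - x))\<^sup>2 - (p' x + q' (n - x))\<^sup>2))"
    by (rule integral_cong) (rule dec)
  also have "\<dots> = integral {0..n} A - integral {0..n} (\<lambda>x. 2 * ((p x + q (n - x))\<^sup>2 - (p' x + q' (n - x))\<^sup>2))"
    by (intro integral_diff integrable_continuous_real continuous_intros contA cont')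
  also have "integral {0..n} (\<lambda>x. 2 * ((p x + q (n - x))\<^sup>2 - (p' x + q' (n - x))\<^sup>2))
     = 2 * (integral {0..n} (\<lambda>x. (p x + q (n - x))\<^sup>2) - integral {0..n} (\<lambda>x. (p' x + q' (n - x))\<^sup>2))"
    unfolding integral_mult_right
    by (subst integral_diff) (auto intro!: integrable_continuous_real continuous_intros cont')
  finally show ?thesis using A0 sq by simp
qed

subsection \<open>Sign changes and convolution\<close>

lemma tendsto_at_right_Icc:
  fixes f :: "real \<Rightarrow> real"
  assumes "continuous_on {0..h} f" "x \<in> {0..<h}"
  shows "(f \<longlongrightarrow> f x) (at_right x)"
proof -
  have "continuous_on {x..h} f"
    using assms by (auto intro: continuous_on_subset)
  then have "(f \<longlongrightarrow> f x) (at x within {x..h})"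
    using assms(2) by (auto simp: continuous_on_def)
  then show ?thesis
    using assms(2) by (simp add: at_within_Icc_at_right)
qed

text \<open>\<open>\<alpha>\<close> is the infimum of the points left of \<open>h\<close> where
  \<open>u\<close> is nonzero. A germ of sign 0 there would extend the zero set beyond
  \<open>\<alpha>\<close>.\<close>

lemma first_sign_change:
  fixes u :: "real \<Rightarrow> real"
  assumes u: "continuous_on {0..h} u" and "0 < h"
    and germ: "\<And>x. x \<in> {0..<h} \<Longrightarrow> \<exists>c. \<forall>\<^sub>F y in at_right x. sgn (u y) = c"
    and ne: "\<not> (\<forall>x\<in>{0..h}. u x = 0)"
  obtains \<alpha> c where "\<alpha> \<in> {0..<h}" "\<And>x. x \<in> {0..<\<alpha>} \<Longrightarrow> u x = 0"
    "c \<noteq> 0" "\<forall>\<^sub>F y in at_right \<alpha>. sgn (u y) = c"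
proof -
  define A where "A = {x\<in>{0..<h}. u x \<noteq> 0}"
  \<comment> \<open>The endpoint \<open>h\<close>, which \<open>A\<close> omits, is reached by
    continuity.\<close>
  have "A \<noteq> {}"
  proof
    assume "A = {}"
    then have z: "u x = 0" if "x \<in> {0..<h}" for x using that by (auto simp: A_def)
    have "u x = 0" if "x \<in> closure {0..<h}" for x
      by (rule continuous_constant_on_closure[OF _ z that])
        (use u \<open>0 < h\<close> in simp_all)
    then show False using ne \<open>0 < h\<close> by simp
  qed
  have bdd: "bdd_below A" by (rule bdd_belowI[of _ 0]) (auto simp: A_def)
  define \<alpha> where "\<alpha> = Inf A"
  obtain x0 where "x0 \<in> A" using \<open>A \<noteq> {}\<close> by blast
  then have "\<alpha> \<le> x0" "0 \<le> \<alpha>" "x0 < h"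
    unfolding \<alpha>_def using bdd \<open>A \<noteq> {}\<close> by (auto intro!: cInf_lower cInf_greatest simp: A_def)
  then have \<alpha>: "\<alpha> \<in> {0..<h}" by simp
  have below: "u x = 0" if "x \<in> {0..<\<alpha>}" for x
    using cInf_lower[OF _ bdd, of x] that \<alpha> by (force simp: A_def \<alpha>_def)
  obtain c where c: "\<forall>\<^sub>F y in at_right \<alpha>. sgn (u y) = c" using germ[OF \<alpha>] by blast
  have "c \<noteq> 0"
  proof
    assume "c = 0"
    with c have ev: "\<forall>\<^sub>F y in at_right \<alpha>. u y = 0" by (simp add: sgn_0_0)
    then obtain b where b: "b > \<alpha>" "\<And>y. \<alpha> < y \<Longrightarrow> y < b \<Longrightarrow> u y = 0"
      unfolding eventually_at_right_field by blast
    have "u \<alpha> = 0"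
      using tendsto_unique[OF _ tendsto_at_right_Icc[OF u \<alpha>] tendsto_eventually[OF ev]] by simp
    then have "b \<le> x" if "x \<in> A" for x
      using that below[of x] b(2)[of x] by (cases x \<alpha> rule: linorder_cases) (auto simp: A_def not_less[symmetric])
    then have "b \<le> \<alpha>" unfolding \<alpha>_def by (rule cInf_greatest[OF \<open>A \<noteq> {}\<close>])
    with b(1) show False by simp
  qed
  with \<alpha> below c show thesis by (intro that)
qed

text \<open>As \<open>c\<close> is 1 or -1, \<open>c * u\<close> is \<open>\<bar>u\<bar>\<close>
  just right of \<open>\<alpha>\<close>; the sign at \<open>\<alpha>\<close> itself follows by
  passing to the limit from the right.\<close>

lemma first_sign_nonneg:
  fixes u :: "real \<Rightarrow> real"
  assumes u: "continuous_on {0..h} u" and \<alpha>: "\<alpha> \<in> {0..<h}"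
    and below: "\<And>x. x \<in> {0..<\<alpha>} \<Longrightarrow> u x = 0"
    and c: "\<forall>\<^sub>F y in at_right \<alpha>. sgn (u y) = c" "c \<noteq> 0"
  obtains e where "0 < e" "\<And>x. x \<in> {0..\<alpha>+e} \<Longrightarrow> 0 \<le> c * u x"
    "\<And>x. x \<in> {\<alpha><..\<alpha>+e} \<Longrightarrow> u x \<noteq> 0"
proof -
  obtain b where b: "b > \<alpha>" "\<And>y. \<alpha> < y \<Longrightarrow> y < b \<Longrightarrow> sgn (u y) = c"
    using c unfolding eventually_at_right_field by blast
  have pos: "0 < c * u y" if "\<alpha> < y" "y < b" for y
  proof -
    have "sgn (u y) = c" by (rule b(2)[OF that])
    moreover then have "u y \<noteq> 0" using c(2) by auto
    ultimately show ?thesis by (auto simp: sgn_if split: if_splits)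
  qed
  have "\<forall>\<^sub>F y in at_right \<alpha>. 0 \<le> c * u y"
    unfolding eventually_at_right_field using b(1) pos by (intro exI[of _ b]) (auto intro: less_imp_le)
  moreover have "((\<lambda>y. c * u y) \<longlongrightarrow> c * u \<alpha>) (at_right \<alpha>)"
    by (intro tendsto_intros tendsto_at_right_Icc[OF u \<alpha>])
  ultimately have "0 \<le> c * u \<alpha>"
    by (intro tendsto_lowerbound[of _ _ "at_right \<alpha>"]) auto
  then have "0 \<le> c * u x" if "0 \<le> x" "x < b" for x
    using below[of x] pos[of x] that by (cases x \<alpha> rule: linorder_cases) auto
  moreover have "u x \<noteq> 0" if "\<alpha> < x" "x < b" for x
    using pos[OF that] by auto
  ultimately show thesis
    using b(1) by (intro that[of "(b - \<alpha>) / 2"]) (auto simp: field_simps)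
qed

text \<open>An elementary case of the Titchmarsh convolution theorem: just right of \<open>\<alpha> + \<beta>\<close> the
  integrand of the convolution has constant sign.\<close>

lemma first_sign_changes_if_conv_eq_0:
  fixes u v :: "real \<Rightarrow> real"
  assumes u: "continuous_on {0..h} u" "\<alpha> \<in> {0..<h}" "\<And>x. x \<in> {0..<\<alpha>} \<Longrightarrow> u x = 0"
      "\<forall>\<^sub>F y in at_right \<alpha>. sgn (u y) = c" "c \<noteq> 0"
    and v: "continuous_on {0..h} v" "\<beta> \<in> {0..<h}" "\<And>x. x \<in> {0..<\<beta>} \<Longrightarrow> v x = 0"
      "\<forall>\<^sub>F y in at_right \<beta>. sgn (v y) = c'" "c' \<noteq> 0"
    and conv: "\<And>n. n \<in> {0<..h} \<Longrightarrow> integral {0..n} (\<lambda>x. u x * v (n - x)) = 0"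
  shows "h \<le> \<alpha> + \<beta>"
proof (rule ccontr)
  assume "\<not> h \<le> \<alpha> + \<beta>"
  obtain e1 where e1: "0 < e1" "\<And>x. x \<in> {0..\<alpha>+e1} \<Longrightarrow> 0 \<le> c * u x"
    "\<And>x. x \<in> {\<alpha><..\<alpha>+e1} \<Longrightarrow> u x \<noteq> 0"
    using first_sign_nonneg[OF u] by blast
  obtain e2 where e2: "0 < e2" "\<And>x. x \<in> {0..\<beta>+e2} \<Longrightarrow> 0 \<le> c' * v x"
    "\<And>x. x \<in> {\<beta><..\<beta>+e2} \<Longrightarrow> v x \<noteq> 0"
    using first_sign_nonneg[OF v] by blast
  define e where "e = min (min e1 e2) (h - \<alpha> - \<beta>)"
  have e: "0 < e" "e \<le> e1" "e \<le> e2" "\<alpha> + \<beta> + e \<le> h"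
    using e1(1) e2(1) \<open>\<not> h \<le> \<alpha> + \<beta>\<close> by (auto simp: e_def)
  define n where "n = \<alpha> + \<beta> + e"
  have n: "n \<in> {0<..h}" using e u(2) v(2) by (auto simp: n_def)
  \<comment> \<open>The constant factor makes the integrand of the convolution nonnegative on all of
    \<open>[0, n]\<close>.\<close>
  define f where "f x = (c * c') * (u x * v (n - x))" for x
  have "0 \<le> f x" if x: "x \<in> {0..n}" for x
  proof -
    \<comment> \<open>As \<open>n = \<alpha> + \<beta> + e\<close>, a point with
      \<open>\<alpha> \<le> x\<close> and \<open>\<beta> \<le> n - x\<close> lies in the window
      where both signs are known; elsewhere one factor is 0.\<close>
    have "x < \<alpha> \<or> n - x < \<beta> \<or> x \<le> \<alpha> + e \<and> n - x \<le> \<beta> + e"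
      unfolding n_def by linarith
    then consider "x < \<alpha>" | "n - x < \<beta>" | "x \<le> \<alpha> + e" "n - x \<le> \<beta> + e"
      by blast
    then show ?thesis
    proof cases
      case 3
      then have "0 \<le> c * u x" "0 \<le> c' * v (n - x)"
        using e1(2)[of x] e2(2)[of "n - x"] e x by auto
      then have "0 \<le> (c * u x) * (c' * v (n - x))" by (rule mult_nonneg_nonneg)
      then show ?thesis by (simp add: f_def mult_ac)
    qed (use u(3)[of x] v(3)[of "n - x"] x in \<open>auto simp: f_def\<close>)
  qed
  moreover have "continuous_on {0..n} f"
    unfolding f_def using n
    by (intro continuous_intros continuous_on_reflect_Icc[OF v(1)] continuous_on_subset[OF u(1)]) auto
  moreover have "integral {0..n} f = 0"
    unfolding f_def using conv[OF n] by simp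
  ultimately have "\<forall>x\<in>{0..n}. f x = 0"
    using integral_eq_0_iff[of 0 n f] n by simp
  \<comment> \<open>At the midpoint of the window the second argument is
    \<open>\<beta> + e / 2\<close>, so neither factor vanishes.\<close>
  then have "f (\<alpha> + e / 2) = 0"
    using e u(2) v(2) by (auto simp: n_def)
  moreover have "u (\<alpha> + e / 2) \<noteq> 0" "v (n - (\<alpha> + e / 2)) \<noteq> 0"
    using e1(3)[of "\<alpha> + e / 2"] e2(3)[of "n - (\<alpha> + e / 2)"] e by (auto simp: n_def field_simps)
  ultimately show False using u(5) v(5) by (simp add: f_def)
qed

text \<open>On an interval where \<open>d\<close> has constant sign, \<open>e\<close> either
  vanishes with \<open>d\<close> or has no zero, and then a constant sign by connectedness.\<close>

lemma sign_germ_pm: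
  fixes d e :: "real \<Rightarrow> real"
  assumes e: "continuous_on {0..h} e" and sq: "\<And>x. x \<in> {0..h} \<Longrightarrow> (d x)\<^sup>2 = (e x)\<^sup>2"
    and x: "x \<in> {0..<h}" and germ: "\<exists>c. \<forall>\<^sub>F y in at_right x. sgn (d y) = c"
  shows "\<exists>c. \<forall>\<^sub>F y in at_right x. sgn (d y - e y) = c"
    and "\<exists>c. \<forall>\<^sub>F y in at_right x. sgn (d y + e y) = c"
proof -
  obtain c b0 where "b0 > x" and c0: "\<And>y. x < y \<Longrightarrow> y < b0 \<Longrightarrow> sgn (d y) = c"
    using germ unfolding eventually_at_right_field by blast
  define b where "b = min b0 h"
  have b: "x < b" "b \<le> h" using \<open>b0 > x\<close> x by (auto simp: b_def)
  have c: "sgn (d y) = c" if "x < y" "y < b" for y using c0 that by (simp add: b_def)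
  have pm: "d y = e y \<or> d y = - e y" if "x < y" "y < b" for y
    using sq[of y] that b x by (auto simp: power2_eq_iff)
  have ev: "\<exists>c. \<forall>\<^sub>F y in at_right x. sgn (f y) = c"
    if "\<And>y. x < y \<Longrightarrow> y < b \<Longrightarrow> sgn (f y) = k" for f and k :: real
    using that b unfolding eventually_at_right_field by blast
  define c' where "c' = sgn (e ((x + b) / 2))"
  have c': "sgn (e y) = c'" if y: "x < y" "y < b" for y
  proof (cases "c = 0")
    case True
    have "e z = 0" if "x < z" "z < b" for z
      using c[OF that] pm[OF that] True by (auto simp: sgn_0_0)
    with y b show ?thesis by (simp add: c'_def)
  next
    case False
    have ne: "0 \<notin> e ` {x<..<b}"
    proof
      assume "0 \<in> e ` {x<..<b}"
      then obtain z where "x < z" "z < b" "e z = 0" by auto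
      then show False using c[of z] pm[of z] False by simp
    qed
    have "continuous_on {x<..<b} e"
      by (rule continuous_on_subset[OF e]) (use x b in auto)
    then have conn: "connected (e ` {x<..<b})"
      by (rule connected_continuous_image) simp
    have "(x + b) / 2 \<in> {x<..<b}" "y \<in> {x<..<b}" using b y by auto
    then have m: "e ((x + b) / 2) \<in> e ` {x<..<b}" "e y \<in> e ` {x<..<b}" by blast+
    have IVT: "0 \<in> e ` {x<..<b}"
      if "s \<in> e ` {x<..<b}" "t \<in> e ` {x<..<b}" "s \<le> 0" "0 \<le> t" for s t
      using conn that unfolding connected_iff_interval by blast
    have "\<not> (e ((x + b) / 2) < 0 \<and> 0 < e y)" "\<not> (e y < 0 \<and> 0 < e ((x + b) / 2))"
      using IVT[OF m] IVT[OF m(2,1)] ne by auto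
    moreover have "e y \<noteq> 0" "e ((x + b) / 2) \<noteq> 0" using m ne by auto
    ultimately show ?thesis by (auto simp: c'_def sgn_if)
  qed
  have double: "sgn (2 * t) = sgn t" for t :: real by (simp add: sgn_if)
  \<comment> \<open>Pointwise \<open>e = d\<close> or \<open>e = - d\<close>, so one of
    \<open>d - e\<close>, \<open>d + e\<close> is 0 and the other is twice \<open>d\<close>; which
    one depends only on whether the two constant signs agree.\<close>
  have same: "sgn (d y - e y) = (if c = c' then 0 else c)"
    "sgn (d y + e y) = (if c = c' then c else 0)" if y: "x < y" "y < b" for y
    using pm[OF y] c[OF y] c'[OF y] double[of "d y"] double[of "e y"]
    by (auto simp: sgn_minus sgn_0_0)
  show "\<exists>c. \<forall>\<^sub>F y in at_right x. sgn (d y - e y) = c"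
    by (rule ev[of _ "if c = c' then 0 else c"]) (rule same)
  show "\<exists>c. \<forall>\<^sub>F y in at_right x. sgn (d y + e y) = c"
    by (rule ev[of _ "if c = c' then c else 0"]) (rule same)
qed

text \<open>If neither sign were global, the first sign changes \<open>\<alpha>\<close> of
  \<open>d - e\<close> and \<open>\<beta>\<close> of \<open>d + e\<close> would satisfy
  \<open>h \<le> \<alpha> + \<beta>\<close>. One of them is at most \<open>\<delta>\<close>, because
  \<open>d\<close> is half the sum of the two functions. The other is then at least
  \<open>h - \<delta>\<close>, beyond which \<open>d\<close> and \<open>e\<close> vanish, so its
  function is identically 0.\<close>

lemma eq_pm_if_conv_eq_0_one_sided:
  fixes d e :: "real \<Rightarrow> real"
  assumes d: "continuous_on {0..h} d" and e: "continuous_on {0..h} e" and "0 < h"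
    and sq: "\<And>x. x \<in> {0..h} \<Longrightarrow> (d x)\<^sup>2 = (e x)\<^sup>2"
    and germ: "\<And>x. x \<in> {0..<h} \<Longrightarrow> \<exists>c. \<forall>\<^sub>F y in at_right x. sgn (d y) = c"
    and conv: "\<And>n. n \<in> {0<..h} \<Longrightarrow>
      integral {0..n} (\<lambda>x. (d x - e x) * (d (n - x) + e (n - x))) = 0"
    and \<delta>: "\<delta> \<in> {0..<h}" "\<forall>\<^sub>F y in at_right \<delta>. sgn (d y) = c" "c \<noteq> 0"
    and tail: "\<And>x. x \<in> {h-\<delta><..h} \<Longrightarrow> d x = 0"
  shows "(\<forall>x\<in>{0..h}. e x = d x) \<or> (\<forall>x\<in>{0..h}. e x = - d x)"
proof (rule ccontr)
  define u v where "u x = d x - e x" and "v x = d x + e x" for x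
  assume "\<not> ?thesis"
  then have ne: "\<not> (\<forall>x\<in>{0..h}. u x = 0)" "\<not> (\<forall>x\<in>{0..h}. v x = 0)"
    unfolding u_def v_def by (metis eq_iff_diff_eq_0, metis eq_neg_iff_add_eq_0 add.commute)
  have cont: "continuous_on {0..h} u" "continuous_on {0..h} v"
    unfolding u_def v_def by (intro continuous_intros d e)+
  have germs: "\<exists>c. \<forall>\<^sub>F y in at_right x. sgn (u y) = c" "\<exists>c. \<forall>\<^sub>F y in at_right x. sgn (v y) = c"
    if "x \<in> {0..<h}" for x
    unfolding u_def v_def using sign_germ_pm[OF e sq that germ[OF that]] by auto
  obtain \<alpha> a where \<alpha>: "\<alpha> \<in> {0..<h}" "\<And>x. x \<in> {0..<\<alpha>} \<Longrightarrow> u x = 0"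
      "\<forall>\<^sub>F y in at_right \<alpha>. sgn (u y) = a" "a \<noteq> 0"
    using first_sign_change[OF cont(1) \<open>0 < h\<close> germs(1) ne(1)] by metis
  obtain \<beta> b where \<beta>: "\<beta> \<in> {0..<h}" "\<And>x. x \<in> {0..<\<beta>} \<Longrightarrow> v x = 0"
      "\<forall>\<^sub>F y in at_right \<beta>. sgn (v y) = b" "b \<noteq> 0"
    using first_sign_change[OF cont(2) \<open>0 < h\<close> germs(2) ne(2)] by metis
  have conv_uv: "integral {0..n} (\<lambda>x. u x * v (n - x)) = 0" if "n \<in> {0<..h}" for n
    using conv[OF that] by (simp only: u_def v_def)
  have "h \<le> \<alpha> + \<beta>"
    by (rule first_sign_changes_if_conv_eq_0[OF cont(1) \<alpha> cont(2) \<beta> conv_uv])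
  moreover have "\<not> (\<delta> < \<alpha> \<and> \<delta> < \<beta>)"
  proof
    assume "\<delta> < \<alpha> \<and> \<delta> < \<beta>"
    then have "\<forall>\<^sub>F y in at_right \<delta>. y < min \<alpha> \<beta> \<and> \<delta> < y"
      unfolding eventually_at_right_field by (intro exI[of _ "min \<alpha> \<beta>"]) simp
    then have "\<forall>\<^sub>F y in at_right \<delta>. sgn (d y) = 0"
    proof eventually_elim
      case (elim y)
      then have "u y = 0" "v y = 0" using \<alpha>(2)[of y] \<beta>(2)[of y] \<delta>(1) by auto
      then show ?case by (simp add: u_def v_def)
    qed
    with \<delta>(2) have "\<forall>\<^sub>F y in at_right \<delta>. c = 0" by eventually_elim simp
    then show False using \<delta>(3) by simp
  qed
  ultimately consider "h - \<delta> \<le> \<alpha>" | "h - \<delta> \<le> \<beta>" by linarith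
  then show False
  proof cases
    case 1
    \<comment> \<open>Since \<open>\<delta> < h\<close>, this case forces
      \<open>0 < \<alpha>\<close>, so the closure contains \<open>\<alpha>\<close>; beyond
      \<open>\<alpha>\<close> the tail condition applies.\<close>
    have "u x = 0" if "x \<in> closure {0..<\<alpha>}" for x
      by (rule continuous_constant_on_closure[OF _ \<alpha>(2) that])
        (use 1 \<alpha>(1) \<delta>(1) in \<open>auto intro: continuous_on_subset[OF cont(1)]\<close>)
    then have "u x = 0" if "x \<in> {0..h}" for x
      using that 1 \<alpha>(1) \<delta>(1) tail[of x] sq[of x]
      by (cases "x \<le> \<alpha>") (auto simp: u_def)
    with ne(1) show False by blast
  next
    case 2
    have "v x = 0" if "x \<in> closure {0..<\<beta>}" for x
      by (rule continuous_constant_on_closure[OF _ \<beta>(2) that])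
        (use 2 \<beta>(1) \<delta>(1) in \<open>auto intro: continuous_on_subset[OF cont(2)]\<close>)
    then have "v x = 0" if "x \<in> {0..h}" for x
      using that 2 \<beta>(1) \<delta>(1) tail[of x] sq[of x]
      by (cases "x \<le> \<beta>") (auto simp: v_def)
    with ne(2) show False by blast
  qed
qed

text \<open>On a bounded interval the convolution leaves the sign of \<open>e = \<plusminus> d\<close> undetermined on a final
  segment as long as the initial segment where \<open>d\<close> vanishes. Reading the interval from the end where
  \<open>d\<close> vanishes for the shorter time, that final segment lies in the zero set of \<open>d\<close>.\<close>

lemma eq_pm_if_conv_eq_0:
  fixes d e :: "real \<Rightarrow> real"
  assumes d: "continuous_on {0..h} d" and e: "continuous_on {0..h} e" and "0 < h"
    and sq: "\<And>x. x \<in> {0..h} \<Longrightarrow> (d x)\<^sup>2 = (e x)\<^sup>2"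
    and germ: "\<And>x. x \<in> {0..<h} \<Longrightarrow> \<exists>c. \<forall>\<^sub>F y in at_right x. sgn (d y) = c"
    and conv: "\<And>n. n \<in> {0<..h} \<Longrightarrow>
      integral {0..n} (\<lambda>x. (d x - e x) * (d (n - x) + e (n - x))) = 0"
    and germ': "\<And>x. x \<in> {0..<h} \<Longrightarrow> \<exists>c. \<forall>\<^sub>F y in at_right x. sgn (d (h - y)) = c"
    and conv': "\<And>n. n \<in> {0<..h} \<Longrightarrow>
      integral {0..n} (\<lambda>x. (d (h - x) - e (h - x)) * (d (h - (n - x)) + e (h - (n - x)))) = 0"
  shows "(\<forall>x\<in>{0..h}. e x = d x) \<or> (\<forall>x\<in>{0..h}. e x = - d x)"
proof (cases "\<forall>x\<in>{0..h}. d x = 0")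
  case True
  then show ?thesis using sq by simp
next
  case False
  have d': "continuous_on {0..h} (\<lambda>x. d (h - x))" and e': "continuous_on {0..h} (\<lambda>x. e (h - x))"
    using continuous_on_reflect_Icc[OF d order_refl] continuous_on_reflect_Icc[OF e order_refl] by auto
  obtain \<alpha> a where \<alpha>: "\<alpha> \<in> {0..<h}" "\<And>x. x \<in> {0..<\<alpha>} \<Longrightarrow> d x = 0"
      "\<forall>\<^sub>F y in at_right \<alpha>. sgn (d y) = a" "a \<noteq> 0"
    using first_sign_change[OF d \<open>0 < h\<close> germ False] by metis
  have "\<not> (\<forall>x\<in>{0..h}. d (h - x) = 0)"
  proof
    assume *: "\<forall>x\<in>{0..h}. d (h - x) = 0"
    have "d x = 0" if "x \<in> {0..h}" for x using bspec[OF *, of "h - x"] that by simp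
    with False show False by blast
  qed
  then obtain \<beta> b where \<beta>: "\<beta> \<in> {0..<h}" "\<And>x. x \<in> {0..<\<beta>} \<Longrightarrow> d (h - x) = 0"
      "\<forall>\<^sub>F y in at_right \<beta>. sgn (d (h - y)) = b" "b \<noteq> 0"
    using first_sign_change[OF d' \<open>0 < h\<close> germ'] by metis
  show ?thesis
  proof (cases "\<alpha> \<le> \<beta>")
    case True
    show ?thesis
    proof (rule eq_pm_if_conv_eq_0_one_sided[OF d e \<open>0 < h\<close> sq germ conv \<alpha>(1,3,4)])
      show "d x = 0" if "x \<in> {h - \<alpha><..h}" for x
        using \<beta>(2)[of "h - x"] that True by simp
    qed
  next
    case False
    have "(\<forall>x\<in>{0..h}. e (h - x) = d (h - x)) \<or> (\<forall>x\<in>{0..h}. e (h - x) = - d (h - x))"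
    proof (rule eq_pm_if_conv_eq_0_one_sided[OF d' e' \<open>0 < h\<close> _ germ' conv' \<beta>(1,3,4)])
      show "d (h - x) = 0" if "x \<in> {h - \<beta><..h}" for x
        using \<alpha>(2)[of "h - x"] that False by simp
      show "(d (h - x))\<^sup>2 = (e (h - x))\<^sup>2" if "x \<in> {0..h}" for x
        using sq[of "h - x"] that by simp
    qed
    moreover have "h - x \<in> {0..h}" "h - (h - x) = x" if "x \<in> {0..h}" for x
      using that by auto
    ultimately show ?thesis by metis
  qed
qed

subsection \<open>Piecewise affine and concave functions\<close>

text \<open>The pairs are slopes and intercepts; domination together with attainment expresses a
  finite minimum.\<close>

definition min_affine_on :: "real set \<Rightarrow> (real \<Rightarrow> real) \<Rightarrow> bool" where
  "min_affine_on S f \<longleftrightarrow> (\<exists>I. finite I \<and>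
    (\<forall>x\<in>S. (\<forall>(a, b)\<in>I. f x \<le> a * x + b) \<and> (\<exists>(a, b)\<in>I. f x = a * x + b)))"

lemma min_affine_on_affine_comp:
  assumes "min_affine_on S f" and T: "\<And>x. x \<in> T \<Longrightarrow> \<alpha> * x + \<beta> \<in> S \<and> g x = f (\<alpha> * x + \<beta>) + k"
  shows "min_affine_on T g"
proof -
  obtain I where I: "finite I" "\<And>x a b. x \<in> S \<Longrightarrow> (a, b) \<in> I \<Longrightarrow> f x \<le> a * x + b"
    "\<And>x. x \<in> S \<Longrightarrow> \<exists>(a, b)\<in>I. f x = a * x + b"
    using assms(1) unfolding min_affine_on_def by blast
  define J where "J = (\<lambda>(a, b). (a * \<alpha>, a * \<beta> + b + k)) ` I"
  have "finite J" using I(1) by (simp add: J_def)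
  moreover have "(\<forall>(a, b)\<in>J. g x \<le> a * x + b) \<and> (\<exists>(a, b)\<in>J. g x = a * x + b)" if "x \<in> T" for x
  proof
    show "\<forall>(a, b)\<in>J. g x \<le> a * x + b"
      using I(2)[of "\<alpha> * x + \<beta>"] T[OF that] by (fastforce simp: J_def algebra_simps)
    obtain a b where "(a, b) \<in> I" "f (\<alpha> * x + \<beta>) = a * (\<alpha> * x + \<beta>) + b"
      using I(3)[of "\<alpha> * x + \<beta>"] T[OF \<open>x \<in> T\<close>] by blast
    then have "(a * \<alpha>, a * \<beta> + b + k) \<in> J" "g x = a * \<alpha> * x + (a * \<beta> + b + k)"
      using T[OF \<open>x \<in> T\<close>] by (force simp: J_def, simp add: algebra_simps)
    then show "\<exists>(a, b)\<in>J. g x = a * x + b" by blast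
  qed
  ultimately show ?thesis unfolding min_affine_on_def by blast
qed

text \<open>Among the pieces active at \<open>x\<close>, the one with the smallest slope stays
  minimal just to the right; inactive pieces lie strictly above at \<open>x\<close> and hence
  nearby.\<close>

lemma min_affine_on_germ:
  assumes "min_affine_on {0..h} f" and x: "x \<in> {0..<h}"
  shows "\<exists>a b. \<forall>\<^sub>F y in at_right x. f y = a * y + b"
proof -
  obtain I where I: "finite I" "\<And>x a b. x \<in> {0..h} \<Longrightarrow> (a, b) \<in> I \<Longrightarrow> f x \<le> a * x + b"
    "\<And>x. x \<in> {0..h} \<Longrightarrow> \<exists>(a, b)\<in>I. f x = a * x + b"
    using assms(1) unfolding min_affine_on_def by blast
  define A where "A = {(a, b) \<in> I. f x = a * x + b}"
  have A: "finite A" "A \<noteq> {}"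
    using I(1) I(3)[of x] x by (auto simp: A_def intro: finite_subset[OF _ I(1)])
  obtain ab where ab: "ab \<in> A" "\<And>cd. cd \<in> A \<Longrightarrow> fst ab \<le> fst cd"
    using ex_min_if_finite[of "fst ` A"] A by (force simp: not_less)
  obtain a b where [simp]: "ab = (a, b)" by (cases ab)
  have ab_I: "(a, b) \<in> I" "f x = a * x + b" using ab(1) by (auto simp: A_def)
  have "\<forall>\<^sub>F y in at_right x. \<forall>cd\<in>I. a * y + b \<le> fst cd * y + snd cd"
  proof (rule eventually_ball_finite[OF I(1)], rule ballI)
    fix cd assume cd: "cd \<in> I"
    obtain c d where [simp]: "cd = (c, d)" by (cases cd)
    show "\<forall>\<^sub>F y in at_right x. a * y + b \<le> fst cd * y + snd cd"
    proof (cases "f x = c * x + d")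
      case True
      then have "a \<le> c" using ab(2)[of cd] cd by (simp add: A_def)
      have "a * y + b \<le> c * y + d" if "x < y" for y
      proof -
        have "a * (y - x) \<le> c * (y - x)" using \<open>a \<le> c\<close> that by (intro mult_right_mono) auto
        then show ?thesis using True ab_I(2) by (simp add: algebra_simps)
      qed
      then show ?thesis
        unfolding eventually_at_right_field by (auto intro: exI[of _ "x + 1"])
    next
      case False
      then have "a * x + b < c * x + d" using I(2)[of x c d] x cd ab_I(2) by auto
      moreover have "((\<lambda>y. (c * y + d) - (a * y + b)) \<longlongrightarrow> (c * x + d) - (a * x + b)) (at_right x)"
        by (intro tendsto_intros)
      ultimately have "\<forall>\<^sub>F y in at_right x. 0 < (c * y + d) - (a * y + b)"
        by (intro order_tendstoD) auto
      then show ?thesis by eventually_elim simp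
    qed
  qed
  moreover have "\<forall>\<^sub>F y in at_right x. x < y \<and> y < h"
    unfolding eventually_at_right_field using x by (auto intro: exI[of _ h])
  ultimately have "\<forall>\<^sub>F y in at_right x. f y = a * y + b"
  proof eventually_elim
    case (elim y)
    then have y: "y \<in> {0..h}" using x by auto
    obtain c d where "(c, d) \<in> I" "f y = c * y + d" using I(3)[OF y] by blast
    then show ?case using elim(1) I(2)[OF y ab_I(1)] by force
  qed
  then show ?thesis by blast
qed

lemma sgn_affine_germ:
  fixes a b x :: real
  shows "\<exists>c. \<forall>\<^sub>F y in at_right x. sgn (a * y + b) = c"
proof -
  have lim: "((\<lambda>y. a * y + b) \<longlongrightarrow> a * x + b) (at_right x)"
    by (intro tendsto_intros)
  consider "a * x + b = 0" | "a * x + b > 0" | "a * x + b < 0" by linarith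
  then show ?thesis
  proof cases
    case 1
    have "sgn (a * y + b) = sgn a" if "x < y" for y
    proof -
      have "a * y + b = a * (y - x)" using 1 by (simp add: algebra_simps)
      then show ?thesis using that by (simp add: sgn_mult)
    qed
    then show ?thesis
      unfolding eventually_at_right_field by (intro exI[of _ "sgn a"] exI[of _ "x + 1"]) simp
  next
    case 2
    then have "\<forall>\<^sub>F y in at_right x. sgn (a * y + b) = 1"
      using order_tendstoD(1)[OF lim, of 0] by (auto elim: eventually_mono)
    then show ?thesis by blast
  next
    case 3
    then have "\<forall>\<^sub>F y in at_right x. sgn (a * y + b) = -1"
      using order_tendstoD(2)[OF lim, of 0] by (auto elim: eventually_mono)
    then show ?thesis by blast
  qed
qed

lemma min_affine_on_diff_sgn_germ:
  assumes "min_affine_on {0..h} f" "min_affine_on {0..h} g" "x \<in> {0..<h}"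
  shows "\<exists>c. \<forall>\<^sub>F y in at_right x. sgn (f y - g y) = c"
proof -
  obtain a b where f: "\<forall>\<^sub>F y in at_right x. f y = a * y + b"
    using min_affine_on_germ[OF assms(1,3)] by blast
  obtain a' b' where g: "\<forall>\<^sub>F y in at_right x. g y = a' * y + b'"
    using min_affine_on_germ[OF assms(2,3)] by blast
  obtain c where "\<forall>\<^sub>F y in at_right x. sgn ((a - a') * y + (b - b')) = c"
    using sgn_affine_germ by blast
  with f g have "\<forall>\<^sub>F y in at_right x. sgn (f y - g y) = c"
    by eventually_elim (simp add: algebra_simps)
  then show ?thesis by blast
qed

text \<open>Concavity gives lower semicontinuity, also at the endpoints: the chords from
  \<open>t\<close> to \<open>a\<close> and to \<open>b\<close> lie below the graph and tend to
  \<open>f t\<close>. Closed superlevel sets give upper semicontinuity.\<close>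

lemma continuous_on_if_concave_on_usc:
  fixes f :: "real \<Rightarrow> real"
  assumes conc: "concave_on {a..b} f" and usc: "\<And>c. closed {x\<in>{a..b}. c \<le> f x}"
  shows "continuous_on {a..b} f"
  unfolding continuous_on_def
proof
  fix t assume t: "t \<in> {a..b}"
  \<comment> \<open>When \<open>t\<close> is an endpoint, the chord to itself is degenerate;
    division by 0 yields 0 and the bound remains true.\<close>
  have chord: "f t + (f w - f t) * ((y - t) / (w - t)) \<le> f y"
    if w: "w \<in> {a..b}" and y: "y \<in> closed_segment t w" for w y
  proof (cases "w = t")
    case False
    obtain l where l: "0 \<le> l" "l \<le> 1" "y = (1 - l) *\<^sub>R t + l *\<^sub>R w"
      using y by (auto simp: closed_segment_def)
    then have "y - t = l * (w - t)" by (simp add: algebra_simps)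
    then have "(y - t) / (w - t) = l" using False by simp
    moreover have "(1 - l) * f t + l * f w \<le> f y"
      unfolding l(3) by (rule concave_onD[OF conc l(1,2) t w])
    ultimately show ?thesis by (simp add: algebra_simps)
  qed (use y in simp)
  have lim: "((\<lambda>y. f t + (f w - f t) * ((y - t) / (w - t))) \<longlongrightarrow> f t) (at t within {a..b})" for w
  proof -
    have "((\<lambda>y. f t + (f w - f t) * ((y - t) * inverse (w - t))) \<longlongrightarrow>
      f t + (f w - f t) * ((t - t) * inverse (w - t))) (at t within {a..b})"
      by (intro tendsto_intros)
    then show ?thesis by (simp add: divide_inverse)
  qed
  have mem: "\<forall>\<^sub>F y in at t within {a..b}. y \<in> {a..b}"
    by (simp add: eventually_at_filter)
  show "(f \<longlongrightarrow> f t) (at t within {a..b})"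
  proof (rule order_tendstoI)
    fix c assume "c < f t"
    then have "\<forall>\<^sub>F y in at t within {a..b}. c < f t + (f w - f t) * ((y - t) / (w - t))" for w
      using order_tendstoD(1)[OF lim] by blast
    from mem this[of a] this[of b] show "\<forall>\<^sub>F y in at t within {a..b}. c < f y"
    proof eventually_elim
      case (elim y)
      have "y \<in> closed_segment t a \<or> y \<in> closed_segment t b"
        using elim(1) t by (auto simp: closed_segment_eq_real_ivl)
      then show ?case using chord[of a y] chord[of b y] elim t by auto
    qed
  next
    fix c assume "f t < c"
    then have "t \<in> - {x\<in>{a..b}. c \<le> f x}" by simp
    then have "\<forall>\<^sub>F y in at t within {a..b}. y \<in> - {x\<in>{a..b}. c \<le> f x}"
      by (rule topological_tendstoD[OF tendsto_ident_at open_Compl[OF usc]])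
    with mem show "\<forall>\<^sub>F y in at t within {a..b}. f y < c"
      by eventually_elim auto
  qed
qed

subsection \<open>Planar convex bodies in an orthonormal frame\<close>

locale frame =
  fixes e z :: "real^2"
  assumes ee: "e \<bullet> e = 1" and zz: "z \<bullet> z = 1" and ez: "e \<bullet> z = 0"
    and expand: "\<And>x. x = (x \<bullet> e) *\<^sub>R e + (x \<bullet> z) *\<^sub>R z"
begin

lemma inner_expand: "x \<bullet> y = (x \<bullet> e) * (y \<bullet> e) + (x \<bullet> z) * (y \<bullet> z)"
proof -
  have "x \<bullet> y = ((x \<bullet> e) *\<^sub>R e + (x \<bullet> z) *\<^sub>R z) \<bullet> y" by (simp only: expand[symmetric])
  then show ?thesis by (simp add: inner_add_left inner_commute[of e] inner_commute[of z])
qed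

lemma coords [simp]: "(s *\<^sub>R e + t *\<^sub>R z) \<bullet> e = s" "(s *\<^sub>R e + t *\<^sub>R z) \<bullet> z = t"
  using ee zz ez by (simp_all add: inner_add_left inner_commute[of z e])

text \<open>Reversing \<open>e\<close> lets each fact about \<open>upper_on\<close> serve the
  opposite boundary as well.\<close>

lemma frame_uminus: "frame (- e) z"
  by unfold_locales (use ee zz ez expand in simp_all)

text \<open>\<open>f\<close> describes the boundary on the side of \<open>e\<close> as a function of
  the height \<open>x \<bullet> z\<close>, and \<open>T\<close> is forced to be the set of all
  heights of \<open>K\<close>.\<close>

definition upper_on :: "(real^2) set \<Rightarrow> real set \<Rightarrow> (real \<Rightarrow> real) \<Rightarrow> bool" where
  "upper_on K T f \<longleftrightarrow> (\<forall>t\<in>T. \<exists>x\<in>K. x \<bullet> z = t \<and> x \<bullet> e = f t) \<and>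
    (\<forall>x\<in>K. x \<bullet> z \<in> T \<and> x \<bullet> e \<le> f (x \<bullet> z))"

lemma ex_upper_on:
  assumes "compact K"
  shows "\<exists>f. upper_on K ((\<lambda>x. x \<bullet> z) ` K) f"
proof -
  have "\<exists>s. (\<exists>x\<in>K. x \<bullet> z = t \<and> x \<bullet> e = s) \<and> (\<forall>x\<in>K. x \<bullet> z = t \<longrightarrow> x \<bullet> e \<le> s)"
    if "t \<in> (\<lambda>x. x \<bullet> z) ` K" for t
  proof -
    have "compact (K \<inter> {x. x \<bullet> z = t})"
      by (intro compact_Int_closed assms closed_Collect_eq continuous_intros)
    moreover have "K \<inter> {x. x \<bullet> z = t} \<noteq> {}" using that by auto
    moreover have "continuous_on (K \<inter> {x. x \<bullet> z = t}) (\<lambda>x. x \<bullet> e)"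
      by (intro continuous_intros)
    ultimately have "\<exists>x\<in>K \<inter> {x. x \<bullet> z = t}. \<forall>y\<in>K \<inter> {x. x \<bullet> z = t}. y \<bullet> e \<le> x \<bullet> e"
      by (rule continuous_attains_sup)
    then show ?thesis by auto
  qed
  then obtain f where "\<And>t. t \<in> (\<lambda>x. x \<bullet> z) ` K \<Longrightarrow>
    (\<exists>x\<in>K. x \<bullet> z = t \<and> x \<bullet> e = f t) \<and> (\<forall>x\<in>K. x \<bullet> z = t \<longrightarrow> x \<bullet> e \<le> f t)"
    by metis
  then show ?thesis unfolding upper_on_def by (intro exI[of _ f]) blast
qed

lemma upper_on_concave:
  assumes f: "upper_on K T f" and "convex K" and "convex T"
  shows "concave_on T f"
  unfolding concave_on_iff
proof (intro conjI ballI allI impI)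
  fix t t' u v :: real assume t: "t \<in> T" "t' \<in> T" and uv: "0 \<le> u" "0 \<le> v" "u + v = 1"
  obtain x where x: "x \<in> K" "x \<bullet> z = t" "x \<bullet> e = f t"
    using f t(1) unfolding upper_on_def by blast
  obtain x' where x': "x' \<in> K" "x' \<bullet> z = t'" "x' \<bullet> e = f t'"
    using f t(2) unfolding upper_on_def by blast
  have "u *\<^sub>R x + v *\<^sub>R x' \<in> K" by (rule convexD[OF \<open>convex K\<close> x(1) x'(1) uv])
  then have "(u *\<^sub>R x + v *\<^sub>R x') \<bullet> e \<le> f ((u *\<^sub>R x + v *\<^sub>R x') \<bullet> z)"
    using f unfolding upper_on_def by blast
  then show "u * f t + v * f t' \<le> f (u *\<^sub>R t + v *\<^sub>R t')"
    using x x' by (simp add: inner_add_left)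
qed (rule assms)

text \<open>Superlevel sets of \<open>f\<close> are projections of the compact sets
  \<open>K \<inter> {x. c \<le> x \<bullet> e}\<close>, hence closed.\<close>

lemma upper_on_continuous:
  assumes f: "upper_on K {a..b} f" and "convex K" and "compact K"
  shows "continuous_on {a..b} f"
proof (rule continuous_on_if_concave_on_usc)
  show "concave_on {a..b} f" by (rule upper_on_concave[OF f \<open>convex K\<close>]) simp
  show "closed {x\<in>{a..b}. c \<le> f x}" for c
  proof -
    have "{x\<in>{a..b}. c \<le> f x} = (\<lambda>x. x \<bullet> z) ` (K \<inter> {x. c \<le> x \<bullet> e})" (is "?L = ?R")
    proof (intro set_eqI iffI)
      fix t assume "t \<in> ?L"
      then show "t \<in> ?R" using f unfolding upper_on_def by force
    next
      fix t assume "t \<in> ?R"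
      then show "t \<in> ?L" using f unfolding upper_on_def by fastforce
    qed
    moreover have "compact \<dots>"
      by (intro compact_continuous_image compact_Int_closed closed_Collect_le continuous_intros \<open>compact K\<close>)
    ultimately show ?thesis by (simp add: compact_imp_closed)
  qed
qed

text \<open>Half-planes whose normal has positive \<open>e\<close>-component bound \<open>f\<close>
  by affine functions of the height. If none of them were active at height \<open>t\<close>, the
  extreme point of \<open>K\<close> there could be pushed further in direction \<open>e\<close>,
  since the other half-planes are not violated by such a move.\<close>

lemma upper_on_min_affine:
  assumes f: "upper_on K T f" and "polyhedron K"
  shows "min_affine_on T f"
proof -
  obtain F where F: "finite F" "K = \<Inter> F" "\<forall>h\<in>F. \<exists>a b. a \<noteq> 0 \<and> h = {x. a \<bullet> x \<le> b}"
    using \<open>polyhedron K\<close> unfolding polyhedron_def by blast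
  then obtain a b where ab: "\<And>h. h \<in> F \<Longrightarrow> h = {x. a h \<bullet> x \<le> b h}" by metis
  have K: "x \<in> K \<longleftrightarrow> (\<forall>h\<in>F. (a h \<bullet> e) * (x \<bullet> e) + (a h \<bullet> z) * (x \<bullet> z) \<le> b h)" for x
  proof -
    have "x \<in> K \<longleftrightarrow> (\<forall>h\<in>F. a h \<bullet> x \<le> b h)" using F(2) ab by blast
    then show ?thesis by (simp only: inner_expand[of _ x])
  qed
  define G where "G = {h\<in>F. 0 < a h \<bullet> e}"
  define I where "I = (\<lambda>h. (- (a h \<bullet> z) / (a h \<bullet> e), b h / (a h \<bullet> e))) ` G"
  have fin: "finite G" "finite I" using F(1) by (simp_all add: G_def I_def)
  have bound: "s \<le> - (a h \<bullet> z) / (a h \<bullet> e) * t + b h / (a h \<bullet> e) \<longleftrightarrow>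
      (a h \<bullet> e) * s + (a h \<bullet> z) * t \<le> b h" if "h \<in> G" for h s t
    using that by (auto simp: G_def field_simps)
  have "(\<forall>(a, b)\<in>I. f t \<le> a * t + b) \<and> (\<exists>(a, b)\<in>I. f t = a * t + b)" if t: "t \<in> T" for t
  proof
    obtain x where x: "x \<in> K" "x \<bullet> z = t" "x \<bullet> e = f t"
      using f t unfolding upper_on_def by blast
    then have xF: "(a h \<bullet> e) * f t + (a h \<bullet> z) * t \<le> b h" if "h \<in> F" for h
      using K[of x] that by auto
    then have le: "f t \<le> - (a h \<bullet> z) / (a h \<bullet> e) * t + b h / (a h \<bullet> e)" if "h \<in> G" for h
      using bound[OF that] that by (simp add: G_def)
    then show "\<forall>(a, b)\<in>I. f t \<le> a * t + b" by (auto simp: I_def)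
    show "\<exists>(a, b)\<in>I. f t = a * t + b"
    proof (rule ccontr)
      \<comment> \<open>The element \<open>f t + 1\<close> keeps the minimum defined when
        \<open>G\<close> is empty.\<close>
      define V where "V = insert (f t + 1) ((\<lambda>h. - (a h \<bullet> z) / (a h \<bullet> e) * t + b h / (a h \<bullet> e)) ` G)"
      define m where "m = Min V"
      assume "\<not> ?thesis"
      then have "f t < - (a h \<bullet> z) / (a h \<bullet> e) * t + b h / (a h \<bullet> e)" if "h \<in> G" for h
        using le[OF that] that unfolding I_def by (force simp: less_le)
      then have "f t < m" using fin by (auto simp: m_def V_def)
      have "m *\<^sub>R e + t *\<^sub>R z \<in> K"
        unfolding K coords
      proof
        fix h assume h: "h \<in> F"
        show "(a h \<bullet> e) * m + (a h \<bullet> z) * t \<le> b h"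
        proof (cases "h \<in> G")
          case True
          then have "m \<le> - (a h \<bullet> z) / (a h \<bullet> e) * t + b h / (a h \<bullet> e)"
            unfolding m_def using fin by (intro Min_le) (auto simp: V_def)
          then show ?thesis using bound[OF True] by blast
        next
          case False
          then have "(a h \<bullet> e) * m \<le> (a h \<bullet> e) * f t"
            using h \<open>f t < m\<close> by (intro mult_left_mono_neg) (auto simp: G_def)
          then show ?thesis using xF[OF h] by simp
        qed
      qed
      then have "(m *\<^sub>R e + t *\<^sub>R z) \<bullet> e \<le> f ((m *\<^sub>R e + t *\<^sub>R z) \<bullet> z)"
        using f unfolding upper_on_def by blast
      then show False using \<open>f t < m\<close> by simp
    qed
  qed
  then show ?thesis unfolding min_affine_on_def using fin by blast
qed

end

section \<open>Sections of shifted bodies and the covariogram\<close>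

lemma in_translation_iff:
  fixes x w :: "'a :: ab_group_add"
  shows "x \<in> (\<lambda>y. y + w) ` K \<longleftrightarrow> x - w \<in> K"
proof
  assume "x - w \<in> K"
  then show "x \<in> (\<lambda>y. y + w) ` K" by (rule image_eqI[rotated]) simp
qed auto

text \<open>A compact convex set projects onto a compact interval whose length is the width. The
  reversal \<open>c - x \<bullet> z\<close> allows heights to be replaced by depths below a fixed
  level.\<close>

lemma width_eq_measure:
  assumes "compact X" "convex X"
  shows "width z X = measure lborel ((\<lambda>x. c - x \<bullet> z) ` X)"
proof (cases "X = {}")
  case False
  have "compact ((\<lambda>x. x \<bullet> z) ` X)" "connected ((\<lambda>x. x \<bullet> z) ` X)"
    by (intro compact_continuous_image connected_continuous_image continuous_intros assms
        convex_connected)+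
  then obtain a b where ab: "(\<lambda>x. x \<bullet> z) ` X = {a..b}"
    using connected_compact_interval_1[of "(\<lambda>x. x \<bullet> z) ` X"] by auto
  then have "a \<le> b" using False by (metis atLeastatMost_empty_iff image_is_empty)
  have "(\<lambda>x. c - x \<bullet> z) ` X = (\<lambda>t. c - t) ` ((\<lambda>x. x \<bullet> z) ` X)" by (simp add: image_image)
  also have "\<dots> = {c - b..c - a}" unfolding ab by simp
  finally show ?thesis
    using False \<open>a \<le> b\<close> unfolding width_def ab by simp
qed (simp add: width_def)

text \<open>For \<open>a \<ge> a0\<close> the constraint on \<open>v\<close> is void.\<close>

lemma measure_superlevel_eq_SUP:
  fixes u v :: "real \<Rightarrow> real"
  assumes u: "continuous_on {0..n} u" and v: "continuous_on {0..n} v"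
    and a0: "\<And>x. x \<in> {0..n} \<Longrightarrow> a0 \<le> u x" "\<And>x. x \<in> {0..n} \<Longrightarrow> - a0 \<le> v x"
  shows "measure lborel {x\<in>{0..n}. c \<le> u x}
    = (SUP a\<in>{c..}. measure lborel {x\<in>{0..n}. a \<le> u x \<and> - a \<le> v x})"
proof -
  have closed: "closed {x\<in>{0..n}. a \<le> u x}" for a
    using continuous_closed_preimage[OF u, of "{a..}"] by (simp add: vimage_def Int_def)
  have mono: "measure lborel {x\<in>{0..n}. a \<le> u x \<and> - a \<le> v x} \<le> measure lborel {x\<in>{0..n}. c \<le> u x}"
    if "c \<le> a" for a
  proof (rule measure_mono_fmeasurable)
    have "closed {x\<in>{0..n}. - a \<le> v x}"
      using continuous_closed_preimage[OF v, of "{-a..}"] by (simp add: vimage_def Int_def)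
    then have "closed ({x\<in>{0..n}. a \<le> u x} \<inter> {x\<in>{0..n}. - a \<le> v x})" by (intro closed_Int closed)
    also have "{x\<in>{0..n}. a \<le> u x} \<inter> {x\<in>{0..n}. - a \<le> v x} = {x\<in>{0..n}. a \<le> u x \<and> - a \<le> v x}" by auto
    finally show "{x\<in>{0..n}. a \<le> u x \<and> - a \<le> v x} \<in> sets lborel" by simp
    show "{x\<in>{0..n}. c \<le> u x} \<in> fmeasurable lborel"
      by (rule fmeasurableI2[OF fmeasurable_cbox[of 0 n]]) (use closed in auto)
  qed (use that in auto)
  define a where "a = max c a0"
  have "{x\<in>{0..n}. a \<le> u x \<and> - a \<le> v x} = {x\<in>{0..n}. c \<le> u x}"
    using a0 by (force simp: a_def)
  then show ?thesis
    by (intro cSup_eq_maximum[symmetric]) (use mono in \<open>auto simp: a_def intro!: image_eqI[of _ _ a]\<close>)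
qed

text \<open>In the body described, \<open>p 0\<close> is the right end of the top and
  \<open>- q 0\<close> the left end of the bottom. A translation along \<open>e\<close> achieves
  \<open>p 0 = q 0\<close>, and exchanging \<open>p\<close> and \<open>q\<close> preserves it. The
  last condition says that no horizontal section is empty.\<close>

definition profile :: "real \<Rightarrow> (real \<Rightarrow> real) \<Rightarrow> (real \<Rightarrow> real) \<Rightarrow> bool" where
  "profile h p q \<longleftrightarrow> 0 < h \<and> continuous_on {0..h} p \<and> continuous_on {0..h} q \<and>
    concave_on {0..h} p \<and> concave_on {0..h} q \<and> p 0 = q 0 \<and> (\<forall>t\<in>{0..h}. - q t \<le> p (h - t))"

text \<open>The witness is the shift along a segment joining a lowest to a highest point of the body.\<close>

lemma profile_chord:
  assumes "profile h p q" and n: "n \<in> {0..h}"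
  obtains a0 where "\<And>x. x \<in> {0..n} \<Longrightarrow> a0 \<le> p x + q (n - x)"
    "\<And>x. x \<in> {0..n} \<Longrightarrow> - a0 \<le> q (h - x) + p (h - (n - x))"
proof -
  have h: "0 < h" and conc: "concave_on {0..h} p" "concave_on {0..h} q"
    and ne: "\<And>t. t \<in> {0..h} \<Longrightarrow> - q t \<le> p (h - t)"
    using assms(1) by (auto simp: profile_def)
  \<comment> \<open>The \<open>e\<close>-coordinate at height \<open>t\<close> on the segment from
    the left end of the bottom to the right end of the top.\<close>
  define s where "s t = (1 - t / h) * - q 0 + (t / h) * p 0" for t
  have chord: "(1 - t / h) * f 0 + (t / h) * f h \<le> f t"
    if "concave_on {0..h} f" "t \<in> {0..h}" for f t
    using concave_onD[OF that(1), of "t / h" 0 h] that(2) h by (auto simp: field_simps)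
  have le: "s t \<le> p (h - t)" "- s t \<le> q t" if t: "t \<in> {0..h}" for t
  proof -
    have ends: "- q 0 \<le> p h" "- p 0 \<le> q h"
      using ne[of 0] ne[of h] h by auto
    have th: "0 \<le> t / h" "0 \<le> 1 - t / h" using t h by auto
    have "s t \<le> (1 - t / h) * p h + (t / h) * p 0"
      unfolding s_def using th ends by (intro add_mono mult_left_mono) auto
    also have "\<dots> = (1 - (h - t) / h) * p 0 + ((h - t) / h) * p h"
      using h by (simp add: field_simps)
    also have "\<dots> \<le> p (h - t)" using chord[OF conc(1), of "h - t"] t by simp
    finally show "s t \<le> p (h - t)" .
    have "- s t = (1 - t / h) * q 0 + (t / h) * - p 0" by (simp add: s_def)
    also have "\<dots> \<le> (1 - t / h) * q 0 + (t / h) * q h"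
      using th ends by (intro add_mono mult_left_mono) auto
    also have "\<dots> \<le> q t" by (rule chord[OF conc(2) t])
    finally show "- s t \<le> q t" .
  qed
  \<comment> \<open>As \<open>s\<close> is affine, the horizontal offset of two points on the
    segment depends only on their height difference, here \<open>h - n\<close>.\<close>
  have diff: "s (h - x) - s (n - x) = s h - s n" for x
    using h by (simp add: s_def field_simps)
  show thesis
  proof (rule that[of "s h - s n"])
    fix x assume x: "x \<in> {0..n}"
    show "s h - s n \<le> p x + q (n - x)"
      using le(1)[of "h - x"] le(2)[of "n - x"] x n diff[of x] by auto
    show "- (s h - s n) \<le> q (h - x) + p (h - (n - x))"
      using le(2)[of "h - x"] le(1)[of "n - x"] x n diff[of x] by auto
  qed
qed

context frame
begin

text \<open>The boundary function \<open>p\<close> is read from the top downwards and \<open>q\<close> from the bottom upwards, so that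
  a point reflection of the slab exchanges \<open>p\<close> and \<open>q\<close>.\<close>

definition slab :: "real \<Rightarrow> (real \<Rightarrow> real) \<Rightarrow> (real \<Rightarrow> real) \<Rightarrow> (real^2) set" where
  "slab h p q = {x. x \<bullet> z \<in> {0..h} \<and> x \<bullet> e \<in> {- q (x \<bullet> z)..p (h - x \<bullet> z)}}"

lemma ex_slab:
  assumes "planar_convex_body K"
  obtains \<tau> h p q where "profile h p q" "K = (\<lambda>x. x + \<tau>) ` slab h p q"
    "polyhedron K \<Longrightarrow> min_affine_on {0..h} p \<and> min_affine_on {0..h} q"
proof -
  interpret m: frame "- e" z by (rule frame_uminus)
  have K: "compact K" "convex K" "interior K \<noteq> {}"
    using assms by (auto simp: planar_convex_body_def)
  have "compact ((\<lambda>x. x \<bullet> z) ` K)" "connected ((\<lambda>x. x \<bullet> z) ` K)"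
    by (intro compact_continuous_image connected_continuous_image continuous_intros K convex_connected)+
  then obtain t0 t1 where T: "(\<lambda>x. x \<bullet> z) ` K = {t0..t1}"
    using connected_compact_interval_1[of "(\<lambda>x. x \<bullet> z) ` K"] by auto
  have "t0 < t1"
  proof -
    obtain x \<epsilon> where x: "0 < \<epsilon>" "cball x \<epsilon> \<subseteq> K"
      using K(3) by (meson ex_in_conv mem_interior_cball)
    have "norm z = 1" using zz by (simp add: norm_eq_sqrt_inner)
    then have "x + \<epsilon> *\<^sub>R z \<in> K" "x \<in> K"
      using x by (auto intro!: subsetD[OF x(2)] simp: dist_norm)
    then have "x \<bullet> z + \<epsilon> \<in> {t0..t1}" "x \<bullet> z \<in> {t0..t1}"
      unfolding T[symmetric] using zz by (force simp: inner_add_left, blast)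
    then show ?thesis using x(1) by auto
  qed
  obtain f where f: "upper_on K {t0..t1} f" using ex_upper_on[OF K(1)] T by auto
  \<comment> \<open>Taken in the frame with \<open>- e\<close>, so the left boundary of
    \<open>K\<close> is \<open>- g\<close>.\<close>
  obtain g where g: "m.upper_on K {t0..t1} g" using m.ex_upper_on[OF K(1)] T by auto
  have K_iff: "x \<in> K \<longleftrightarrow> x \<bullet> z \<in> {t0..t1} \<and> - g (x \<bullet> z) \<le> x \<bullet> e \<and> x \<bullet> e \<le> f (x \<bullet> z)" (is "_ \<longleftrightarrow> ?R") for x
  proof
    assume "x \<in> K"
    then show ?R using f g unfolding upper_on_def m.upper_on_def by force
  next
    assume R: ?R
    obtain y where y: "y \<in> K" "y \<bullet> z = x \<bullet> z" "y \<bullet> e = f (x \<bullet> z)"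
      using f R unfolding upper_on_def by blast
    obtain y' where y': "y' \<in> K" "y' \<bullet> z = x \<bullet> z" "y' \<bullet> e = - g (x \<bullet> z)"
      using g R unfolding m.upper_on_def by force
    have "x \<bullet> e \<in> closed_segment (y' \<bullet> e) (y \<bullet> e)"
      using R y y' by (simp add: closed_segment_eq_real_ivl)
    then obtain l where l: "0 \<le> l" "l \<le> 1" "x \<bullet> e = (1 - l) * (y' \<bullet> e) + l * (y \<bullet> e)"
      by (auto simp: closed_segment_def)
    define w where "w = (1 - l) *\<^sub>R y' + l *\<^sub>R y"
    have "w \<bullet> e = x \<bullet> e" "w \<bullet> z = x \<bullet> z"
      using l y y' by (simp_all add: w_def inner_add_left algebra_simps)
    then have "w = x" using expand[of w] expand[of x] by simp
    moreover have "w \<in> K" unfolding w_def using convexD[OF K(2) y'(1) y(1), of "1 - l" l] l by simp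
    ultimately show "x \<in> K" by simp
  qed
  \<comment> \<open>\<open>k\<close> is the horizontal shift that equalizes
    \<open>p 0 = f t1 - k\<close> and \<open>q 0 = g t0 + k\<close>.\<close>
  define h k where "h = t1 - t0" and "k = (f t1 - g t0) / 2"
  \<comment> \<open>The factors \<open>- 1\<close> and \<open>1\<close> are written out to match the
    lemmas on affine substitution.\<close>
  define p q where "p x = f (- 1 * x + t1) + - k" and "q x = g (1 * x + t0) + k" for x
  define \<tau> where "\<tau> = k *\<^sub>R e + t0 *\<^sub>R z"
  have range: "- 1 * x + t1 \<in> {t0..t1}" "1 * x + t0 \<in> {t0..t1}" if "x \<in> {0..h}" for x
    using that by (auto simp: h_def)
  have "profile h p q"
    unfolding profile_def
  proof (intro conjI ballI)
    show "continuous_on {0..h} p" "continuous_on {0..h} q"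
      unfolding p_def q_def
      by (rule continuous_on_affine_comp[OF upper_on_continuous[OF f K(2,1)] range(1)]
          continuous_on_affine_comp[OF m.upper_on_continuous[OF g K(2,1)] range(2)]; assumption)+
    show "concave_on {0..h} p" "concave_on {0..h} q"
      unfolding p_def q_def
      by (rule concave_on_affine_comp[OF upper_on_concave[OF f K(2)] _ range(1)]
          concave_on_affine_comp[OF m.upper_on_concave[OF g K(2)] _ range(2)]; simp)+
    show "p 0 = q 0" by (simp add: p_def q_def k_def field_simps)
    fix t assume "t \<in> {0..h}"
    then have t: "t + t0 \<in> {t0..t1}" by (auto simp: h_def)
    then obtain x where "x \<in> K" "x \<bullet> z = t + t0" unfolding T[symmetric] by auto
    with K_iff[of x] show "- q t \<le> p (h - t)" by (simp add: p_def q_def h_def algebra_simps)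
  qed (use \<open>t0 < t1\<close> in \<open>simp add: h_def\<close>)
  moreover have "K = (\<lambda>x. x + \<tau>) ` slab h p q"
  proof -
    have "x \<in> K \<longleftrightarrow> x - \<tau> \<in> slab h p q" for x
    proof -
      have "(x - \<tau>) \<bullet> e = x \<bullet> e - k" "(x - \<tau>) \<bullet> z = x \<bullet> z - t0"
        unfolding \<tau>_def inner_diff_left by simp_all
      then show ?thesis
        unfolding K_iff slab_def by (auto simp: p_def q_def h_def)
    qed
    then show ?thesis by (simp add: set_eq_iff in_translation_iff)
  qed
  moreover have "min_affine_on {0..h} p \<and> min_affine_on {0..h} q" if "polyhedron K"
    using min_affine_on_affine_comp[OF upper_on_min_affine[OF f that], of "{0..h}" "- 1" t1 p]
      min_affine_on_affine_comp[OF m.upper_on_min_affine[OF g that], of "{0..h}" 1 t0 q] range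
    unfolding p_def q_def by blast
  ultimately show thesis by (rule that)
qed

text \<open>At depth \<open>x\<close> below the top, the sections of the slab and of its shifted
  copy are \<open>[- q (h - x), p x]\<close> and
  \<open>[a - q (n - x), a + p (h - (n - x))]\<close>. They meet iff each left end is at most the
  other right end.\<close>

lemma covariogram_slab:
  assumes prof: "profile h p q" and K: "K = (\<lambda>x. x + \<tau>) ` slab h p q" "compact K" "convex K"
    and n: "n \<in> {0..h}"
  shows "covariogram (width z) K (a *\<^sub>R e + (h - n) *\<^sub>R z) =
    measure lborel {x\<in>{0..n}. a \<le> p x + q (n - x) \<and> - a \<le> q (h - x) + p (h - (n - x))}"
proof -
  define w where "w = a *\<^sub>R e + (h - n) *\<^sub>R z"
  define X where "X = K \<inter> (\<lambda>y. y + w) ` K"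
  have w: "w \<bullet> e = a" "w \<bullet> z = h - n" by (simp_all add: w_def)
  have mem: "x \<in> X \<longleftrightarrow> x - \<tau> \<in> slab h p q \<and> x - \<tau> - w \<in> slab h p q" for x
  proof -
    have K': "x \<in> K \<longleftrightarrow> x - \<tau> \<in> slab h p q" for x
      unfolding K(1) by (rule in_translation_iff)
    have "x - w - \<tau> = x - \<tau> - w" by simp
    then show ?thesis by (simp only: X_def Int_iff in_translation_iff K')
  qed
  have ne: "- q t \<le> p (h - t)" if "t \<in> {0..h}" for t
    using prof that by (auto simp: profile_def)
  have "compact ((\<lambda>y. y + w) ` K)" "convex ((\<lambda>y. y + w) ` K)"
    using compact_translation[OF K(2), of w] convex_translation[OF K(3), of w]
    by (simp_all add: add.commute)
  then have X: "compact X" "convex X"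
    unfolding X_def using K by (auto intro: compact_Int convex_Int)
  \<comment> \<open>The height of the top of \<open>K\<close>.\<close>
  define c where "c = \<tau> \<bullet> z + h"
  define J where "J = {x\<in>{0..n}. a \<le> p x + q (n - x) \<and> - a \<le> q (h - x) + p (h - (n - x))}"
  have "(\<lambda>x. c - x \<bullet> z) ` X = J"
  proof (intro set_eqI iffI)
    fix t assume "t \<in> (\<lambda>x. c - x \<bullet> z) ` X"
    then obtain x where x: "x \<in> X" "t = c - x \<bullet> z" by blast
    define y where "y = x - \<tau>"
    have y: "y \<in> slab h p q" "y - w \<in> slab h p q" using x(1) mem by (auto simp: y_def)
    have yz: "y \<bullet> z = h - t" "(y - w) \<bullet> z = n - t" "(y - w) \<bullet> e = y \<bullet> e - a"
      using x(2) by (simp_all add: y_def c_def inner_diff_left w)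
    from y show "t \<in> J" unfolding slab_def mem_Collect_eq yz J_def by auto
  next
    fix t assume t: "t \<in> J"
    \<comment> \<open>The larger of the two left ends, hence the left end of the common
      section.\<close>
    define s where "s = max (- q (h - t)) (a - q (n - t))"
    define y where "y = s *\<^sub>R e + (h - t) *\<^sub>R z"
    have yz: "y \<bullet> e = s" "y \<bullet> z = h - t" "(y - w) \<bullet> z = n - t" "(y - w) \<bullet> e = s - a"
      by (simp_all add: y_def inner_diff_left w)
    have "y \<in> slab h p q" "y - w \<in> slab h p q"
      unfolding slab_def mem_Collect_eq yz
      using t n ne[of "h - t"] ne[of "n - t"] by (auto simp: J_def s_def)
    then have "y + \<tau> \<in> X" by (simp add: mem algebra_simps)
    moreover have "t = c - (y + \<tau>) \<bullet> z" by (simp add: c_def inner_add_left yz)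
    ultimately show "t \<in> (\<lambda>x. c - x \<bullet> z) ` X" by blast
  qed
  then show ?thesis
    using width_eq_measure[OF X, of z c] unfolding covariogram_def w_def[symmetric] X_def[symmetric] J_def by simp
qed

text \<open>The supremum over \<open>a \<ge> c\<close> removes the second constraint without
  mentioning the bound \<open>a0\<close> of the particular body, so the right-hand sides depend on
  the body only through \<open>h\<close> and its covariogram.\<close>

lemma sum_dist_eq_SUP_covariogram:
  assumes prof: "profile h p q" and K: "K = (\<lambda>x. x + \<tau>) ` slab h p q" "compact K" "convex K"
    and n: "n \<in> {0..h}"
  shows "sum_dist p q n c = (SUP a\<in>{c..}. covariogram (width z) K (a *\<^sub>R e + (h - n) *\<^sub>R z))"
    and "sum_dist (\<lambda>x. q (h - x)) (\<lambda>x. p (h - x)) n c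
      = (SUP a\<in>{c..}. covariogram (width z) K ((- a) *\<^sub>R e + (h - n) *\<^sub>R z))"
proof -
  have cont: "continuous_on {0..h} p" "continuous_on {0..h} q" using prof by (auto simp: profile_def)
  have le: "n \<le> h" using n by simp
  obtain a0 where a0: "\<And>x. x \<in> {0..n} \<Longrightarrow> a0 \<le> p x + q (n - x)"
    "\<And>x. x \<in> {0..n} \<Longrightarrow> - a0 \<le> q (h - x) + p (h - (n - x))"
    using profile_chord[OF prof n] by blast
  have u: "continuous_on {0..n} (\<lambda>x. p x + q (n - x))"
    by (rule continuous_on_conv_sum[OF cont le])
  have v: "continuous_on {0..n} (\<lambda>x. q (h - x) + p (h - (n - x)))"
    by (rule continuous_on_conv_sum[OF continuous_on_reflect_Icc[OF cont(2) order_refl]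
          continuous_on_reflect_Icc[OF cont(1) order_refl] le])
  show "sum_dist p q n c = (SUP a\<in>{c..}. covariogram (width z) K (a *\<^sub>R e + (h - n) *\<^sub>R z))"
    unfolding sum_dist_def covariogram_slab[OF prof K n]
    by (rule measure_superlevel_eq_SUP[OF u v a0])
  \<comment> \<open>For the mirror image the two constraints exchange roles, with
    \<open>- a0\<close> as the bound.\<close>
  have "- (- a0) \<le> p x + q (n - x)" if "x \<in> {0..n}" for x using a0(1)[OF that] by simp
  from measure_superlevel_eq_SUP[OF v u a0(2) this, of c]
  show "sum_dist (\<lambda>x. q (h - x)) (\<lambda>x. p (h - x)) n c
      = (SUP a\<in>{c..}. covariogram (width z) K ((- a) *\<^sub>R e + (h - n) *\<^sub>R z))"
    unfolding sum_dist_def covariogram_slab[OF prof K n] by (simp only: minus_minus conj_commute)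
qed

text \<open>Reads off \<open>h\<close>, so that the profiles of two bodies with equal covariograms
  live on the same interval.\<close>

lemma covariogram_slab_0:
  assumes prof: "profile h p q" and K: "K = (\<lambda>x. x + \<tau>) ` slab h p q" "compact K" "convex K"
  shows "covariogram (width z) K 0 = h"
proof -
  have h: "0 < h" and ne: "\<And>t. t \<in> {0..h} \<Longrightarrow> - q t \<le> p (h - t)"
    using prof by (auto simp: profile_def)
  have "{x\<in>{0..h}. 0 \<le> p x + q (h - x) \<and> - 0 \<le> q (h - x) + p (h - (h - x))} = {0..h}"
    (is "?L = _")
  proof (intro set_eqI iffI)
    fix x assume x: "x \<in> {0..h}"
    then show "x \<in> ?L" using ne[of "h - x"] by simp
  qed simp
  then show ?thesis
    using covariogram_slab[OF prof K, of h 0] h by simp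
qed

text \<open>The map is the reflection at the point \<open>(h / 2) *\<^sub>R z\<close>.\<close>

lemma slab_swap: "slab h q p = (\<lambda>x. h *\<^sub>R z - x) ` slab h p q"
proof -
  have mem: "h *\<^sub>R z - x \<in> slab h p q \<longleftrightarrow> x \<in> slab h q p" for h p q x
  proof -
    have "(h *\<^sub>R z - x) \<bullet> e = - (x \<bullet> e)" "(h *\<^sub>R z - x) \<bullet> z = h - x \<bullet> z"
      using ez zz by (simp_all add: inner_diff_left inner_commute[of z e])
    then show ?thesis unfolding slab_def by auto
  qed
  show ?thesis
  proof (intro set_eqI iffI)
    fix x assume "x \<in> slab h q p"
    then have "h *\<^sub>R z - x \<in> slab h p q" by (simp only: mem)
    then show "x \<in> (\<lambda>x. h *\<^sub>R z - x) ` slab h p q" by (rule image_eqI[rotated]) simp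
  qed (use mem in auto)
qed

lemma slab_cong:
  assumes "\<And>x. x \<in> {0..h} \<Longrightarrow> p x = p' x" "\<And>x. x \<in> {0..h} \<Longrightarrow> q x = q' x"
  shows "slab h p q = slab h p' q'"
  unfolding slab_def using assms by auto

end

section \<open>Reconstruction of the polygon from its covariogram\<close>

lemma frame_rotate:
  fixes z :: "real^2"
  assumes "norm z = 1"
  shows "frame (vector [- z $ 2, z $ 1]) z"
proof
  have zz: "z $ 1 * z $ 1 + z $ 2 * z $ 2 = 1"
    using assms by (simp add: norm_eq_1 inner_vec_def sum_2)
  then show "z \<bullet> z = 1" "vector [- z $ 2, z $ 1] \<bullet> (vector [- z $ 2, z $ 1] :: real^2) = 1"
    by (simp_all add: inner_vec_def sum_2)
  show "vector [- z $ 2, z $ 1] \<bullet> z = 0" by (simp add: inner_vec_def sum_2)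
  fix x :: "real^2"
  have "x $ 1 = (x $ 2 * z $ 1 - x $ 1 * z $ 2) * - z $ 2 + (x $ 1 * z $ 1 + x $ 2 * z $ 2) * z $ 1"
    "x $ 2 = (x $ 2 * z $ 1 - x $ 1 * z $ 2) * z $ 1 + (x $ 1 * z $ 1 + x $ 2 * z $ 2) * z $ 2"
    using zz by algebra+
  then show "x = (x \<bullet> vector [- z $ 2, z $ 1]) *\<^sub>R vector [- z $ 2, z $ 1] + (x \<bullet> z) *\<^sub>R z"
    by (simp add: vec_eq_iff forall_2 inner_vec_def sum_2)
qed

text \<open>The sums agree, and the differences \<open>d\<close>, \<open>d'\<close> agree up to a
  pointwise sign, which the convolution identities from the bottom and from the top make global. Sum
  and difference then recover the pair up to exchange.\<close>

lemma profile_determined: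
  assumes prof: "profile h p q" "profile h p' q'"
    and pl: "min_affine_on {0..h} p" "min_affine_on {0..h} q"
    and dist: "\<And>n. n \<in> {0<..h} \<Longrightarrow> sum_dist p q n = sum_dist p' q' n"
    and dist': "\<And>n. n \<in> {0<..h} \<Longrightarrow> sum_dist (\<lambda>x. q (h - x)) (\<lambda>x. p (h - x)) n
      = sum_dist (\<lambda>x. q' (h - x)) (\<lambda>x. p' (h - x)) n"
  shows "(\<forall>x\<in>{0..h}. p' x = p x \<and> q' x = q x) \<or> (\<forall>x\<in>{0..h}. p' x = q x \<and> q' x = p x)"
proof -
  have h: "0 < h" and cont: "continuous_on {0..h} p" "continuous_on {0..h} q"
      "continuous_on {0..h} p'" "continuous_on {0..h} q'"
    and conc: "concave_on {0..h} p" "concave_on {0..h} q"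
      "concave_on {0..h} p'" "concave_on {0..h} q'"
    and zero: "p 0 = q 0" "p' 0 = q' 0"
    using prof by (auto simp: profile_def)
  note cont_refl = cont[THEN continuous_on_reflect_Icc, OF order_refl]
  have sum: "p x + q x = p' x + q' x" if "x \<in> {0..h}" for x
    by (rule sum_eq_if_sum_dist_eq[OF cont h dist that])
  have sq: "(p x - q x)\<^sup>2 = (p' x - q' x)\<^sup>2" if "x \<in> {0..h}" for x
    by (rule diff_sq_eq_if_sum_dist_eq[OF cont conc h dist zero that])
  \<comment> \<open>Obtained by substitution: the reversed pair need not agree at 0, as the
    comparison of minima would require.\<close>
  have sum': "q (h - x) + p (h - x) = q' (h - x) + p' (h - x)"
    and sq': "(q (h - x) - p (h - x))\<^sup>2 = (q' (h - x) - p' (h - x))\<^sup>2" if "x \<in> {0..h}" for x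
    using sum[of "h - x"] sq[of "h - x"] that by (simp_all add: power2_commute add.commute)
  have pl': "min_affine_on {0..h} (\<lambda>x. p (h - x))" "min_affine_on {0..h} (\<lambda>x. q (h - x))"
    by (rule pl[THEN min_affine_on_affine_comp, where \<alpha> = "- 1" and \<beta> = h and k = 0]; simp)+
  have "(\<forall>x\<in>{0..h}. p' x - q' x = p x - q x) \<or> (\<forall>x\<in>{0..h}. p' x - q' x = - (p x - q x))"
  proof (rule eq_pm_if_conv_eq_0[OF _ _ h sq])
    show "continuous_on {0..h} (\<lambda>x. p x - q x)" "continuous_on {0..h} (\<lambda>x. p' x - q' x)"
      by (intro continuous_intros cont)+
    show "\<exists>c. \<forall>\<^sub>F y in at_right x. sgn (p y - q y) = c" if "x \<in> {0..<h}" for x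
      by (rule min_affine_on_diff_sgn_germ[OF pl that])
    show "\<exists>c. \<forall>\<^sub>F y in at_right x. sgn (p (h - y) - q (h - y)) = c" if "x \<in> {0..<h}" for x
      by (rule min_affine_on_diff_sgn_germ[OF pl' that])
    fix n assume n: "n \<in> {0<..h}"
    show "integral {0..n} (\<lambda>x. (p x - q x - (p' x - q' x)) *
        (p (n - x) - q (n - x) + (p' (n - x) - q' (n - x)))) = 0"
      by (rule conv_eq_0_if_sum_dist_eq[OF cont _ dist[OF n] sum sq]) (use n in auto)
    \<comment> \<open>Reversal puts \<open>q\<close> first, so both factors change sign and the
      product stays the same.\<close>
    have "integral {0..n} (\<lambda>x. (q (h - x) - p (h - x) - (q' (h - x) - p' (h - x))) *
        (q (h - (n - x)) - p (h - (n - x)) + (q' (h - (n - x)) - p' (h - (n - x))))) = 0"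
      by (rule conv_eq_0_if_sum_dist_eq[OF cont_refl(2,1,4,3) _ dist'[OF n] sum' sq']) (use n in auto)
    then show "integral {0..n} (\<lambda>x. (p (h - x) - q (h - x) - (p' (h - x) - q' (h - x))) *
        (p (h - (n - x)) - q (h - (n - x)) + (p' (h - (n - x)) - q' (h - (n - x))))) = 0"
      by (simp add: algebra_simps)
  qed
  then show ?thesis
  proof (elim disjE)
    assume *: "\<forall>x\<in>{0..h}. p' x - q' x = p x - q x"
    have "p' x = p x \<and> q' x = q x" if "x \<in> {0..h}" for x
      using sum[OF that] bspec[OF * that] by linarith
    then show ?thesis by blast
  next
    assume *: "\<forall>x\<in>{0..h}. p' x - q' x = - (p x - q x)"
    have "p' x = q x \<and> q' x = p x" if "x \<in> {0..h}" for x
      using sum[OF that] bspec[OF * that] by linarith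
    then show ?thesis by blast
  qed
qed

theorem theorem1p3:
  fixes z :: "real^2" and P Q :: "(real^2) set"
  assumes "z \<in> sphere 0 1"
    and "convex_polygon P"
    and "planar_convex_body Q"
    and "covariogram (width z) Q = covariogram (width z) P"
  shows "\<exists>\<tau>. Q = (\<lambda>p. p + \<tau>) ` P \<or> Q = (\<lambda>p. - p + \<tau>) ` P"
proof -
  interpret frame "vector [- z $ 2, z $ 1]" z
    by (rule frame_rotate) (use assms(1) in simp)
  have P: "planar_convex_body P" "polyhedron P"
    using assms(2) polytope_imp_polyhedron by (auto simp: convex_polygon_def)
  have comp: "compact P" "convex P" "compact Q" "convex Q"
    using P(1) assms(3) by (auto simp: planar_convex_body_def)
  obtain \<tau> h p q where p: "profile h p q" "P = (\<lambda>x. x + \<tau>) ` slab h p q"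
    and pl: "min_affine_on {0..h} p" "min_affine_on {0..h} q"
    using ex_slab[OF P(1)] P(2) by metis
  obtain \<tau>' h' p' q' where p': "profile h' p' q'" "Q = (\<lambda>x. x + \<tau>') ` slab h' p' q'"
    using ex_slab[OF assms(3)] by metis
  have "h' = h"
    using covariogram_slab_0[OF p comp(1,2)] covariogram_slab_0[OF p' comp(3,4)] assms(4) by simp
  note p' = p'[unfolded \<open>h' = h\<close>]
  have "(\<forall>x\<in>{0..h}. p' x = p x \<and> q' x = q x) \<or> (\<forall>x\<in>{0..h}. p' x = q x \<and> q' x = p x)"
  \<comment> \<open>With \<open>h' = h\<close>, both distributions are the same supremum of the
    common covariogram.\<close>
  proof (rule profile_determined[OF p(1) p'(1) pl]; rule ext)
    fix n c assume "n \<in> {0<..h}"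
    then have n: "n \<in> {0..h}" by simp
    show "sum_dist p q n c = sum_dist p' q' n c"
      unfolding sum_dist_eq_SUP_covariogram(1)[OF p comp(1,2) n]
        sum_dist_eq_SUP_covariogram(1)[OF p' comp(3,4) n] assms(4) ..
    show "sum_dist (\<lambda>x. q (h - x)) (\<lambda>x. p (h - x)) n c = sum_dist (\<lambda>x. q' (h - x)) (\<lambda>x. p' (h - x)) n c"
      unfolding sum_dist_eq_SUP_covariogram(2)[OF p comp(1,2) n]
        sum_dist_eq_SUP_covariogram(2)[OF p' comp(3,4) n] assms(4) ..
  qed
  then show ?thesis
  proof (elim disjE)
    assume "\<forall>x\<in>{0..h}. p' x = p x \<and> q' x = q x"
    then have "slab h p' q' = slab h p q" by (intro slab_cong) auto
    then have "Q = (\<lambda>x. x + (\<tau>' - \<tau>)) ` P" by (simp add: p(2) p'(2) image_image)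
    then show ?thesis by blast
  next
    assume "\<forall>x\<in>{0..h}. p' x = q x \<and> q' x = p x"
    then have "slab h p' q' = slab h q p" by (intro slab_cong) auto
    then have "Q = (\<lambda>x. - x + (h *\<^sub>R z + \<tau> + \<tau>')) ` P"
      by (simp add: p(2) p'(2) slab_swap[of h q p] image_image algebra_simps)
    then show ?thesis by blast
  qed
qed

end
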